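(* Let $V$ be a normal matrix ordered $*$-operator space. Then there exist a Hilbert space $H$ and a linear map $\phi:V\to B(H)$ which is a completely isometric complete order embedding: for all $n,m\in\mathbb{N}$ and $A\in M_{n,m}(V)$, $\|\phi^{(n,m)}(A)\|_{B(H^m,H^n)}=\|A\|_{n,m}$, and for all $n$ and $A\in M_n(V)$, $\phi^{(n)}(A)\ge0$ in $M_n(B(H))$ if and only if $A\in M_n(V)_+$.
   Context: A $*$-vector space is a complex vector space with a conjugate-linear involution $x\mapsto x^*$; $M_{n,m}(V)$ gets the involution $(x_{ij})^*=(x_{ji}^* )\in M_{m,n}(V)$ and $M_n(V)_{sa}$ denotes the self-adjoint elements of $M_n(V)$. An (abstract) operator space is a complex vector space $V$ with norms $\|\cdot\|_{n,m}$ on $M_{n,m}(V)$ such that $\|XAY\|_{k,l}\le\|X\|\|A\|_{n,m}\|Y\|$ for scalar $X\in M_{k,n}$, $Y\in M_{m,l}$, and $\|A\oplus B\|=\max\{\|A\|,\|B\|\}$. A $*$-operator space is an operator space which is a $*$-vector space with $\|A^*\|_{m,n}=\|A\|_{n,m}$. It is matrix ordered if for each $n$ there is a proper cone $M_n(V)_+\subseteq M_n(V)_{sa}$ such that $A\in M_n(V)_+$, $B\in M_k(V)_+$, $X\in M_{l,k}$ imply $A\oplus B\in M_{n+k}(V)_+$ and $XBX^*\in M_l(V)_+$. It is normal if for every $n$, $(M_n(V)_{sa},\|\cdot\|_{n,n},M_n(V)_+)$ is a normal ordered vector space, i.e. $M_n(V)_+$ is norm closed and $A\le B\le C$ implies $\|B\|\le\max\{\|A\|,\|C\|\}$.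 $\phi^{(n,m)}(a_{ij})=(\phi(a_{ij}))$ and $\phi^{(n)}=\phi^{(n,n)}$; $M_{n,m}(B(H))$ is identified with $B(H^m,H^n)$. *)

theory Defs
  imports "HOL-Analysis.Analysis"
begin

text \<open>An n x m matrix over V is represented as a function nat => nat => 'v which vanishes
outside the index range {0..<n} x {0..<m}.  Scalar matrices are functions nat => nat => complex,
of which only the entries in the index range are used.\<close>

definition mats :: "nat \<Rightarrow> nat \<Rightarrow> (nat \<Rightarrow> nat \<Rightarrow> 'v::zero) set" where
  "mats n m = {A. \<forall>i j. A i j \<noteq> 0 \<longrightarrow> i < n \<and> j < m}"

definition mstar :: "('v \<Rightarrow> 'v) \<Rightarrow> (nat \<Rightarrow> nat \<Rightarrow> 'v) \<Rightarrow> (nat \<Rightarrow> nat \<Rightarrow> 'v)" where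
  "mstar st A = (\<lambda>i j. st (A j i))"

definition mscale :: "(complex \<Rightarrow> 'v::ab_group_add \<Rightarrow> 'v) \<Rightarrow> complex \<Rightarrow> (nat \<Rightarrow> nat \<Rightarrow> 'v) \<Rightarrow> (nat \<Rightarrow> nat \<Rightarrow> 'v)" where
  "mscale sc c A = (\<lambda>i j. sc c (A i j))"

definition smul3 :: "(complex \<Rightarrow> 'v::ab_group_add \<Rightarrow> 'v) \<Rightarrow> nat \<Rightarrow> nat \<Rightarrow> nat \<Rightarrow> nat \<Rightarrow> (nat \<Rightarrow> nat \<Rightarrow> complex) \<Rightarrow>
    (nat \<Rightarrow> nat \<Rightarrow> 'v) \<Rightarrow> (nat \<Rightarrow> nat \<Rightarrow> complex) \<Rightarrow> (nat \<Rightarrow> nat \<Rightarrow> 'v)" where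
  "smul3 sc k n m l X A Y = (\<lambda>i j. if i < k \<and> j < l
      then (\<Sum>p<n. \<Sum>q<m. sc (X i p * Y q j) (A p q)) else 0)"

definition dsum :: "nat \<Rightarrow> nat \<Rightarrow> (nat \<Rightarrow> nat \<Rightarrow> 'v::zero) \<Rightarrow> (nat \<Rightarrow> nat \<Rightarrow> 'v) \<Rightarrow> (nat \<Rightarrow> nat \<Rightarrow> 'v)" where
  "dsum n m A B = (\<lambda>i j. if i < n \<and> j < m then A i j
                         else if n \<le> i \<and> m \<le> j then B (i - n) (j - m) else 0)"

definition cstar :: "(nat \<Rightarrow> nat \<Rightarrow> complex) \<Rightarrow> (nat \<Rightarrow> nat \<Rightarrow> complex)" where
  "cstar X = (\<lambda>i j. cnj (X j i))"

definition vnorm :: "nat \<Rightarrow> (nat \<Rightarrow> complex) \<Rightarrow> real" where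
  "vnorm n v = sqrt (\<Sum>j<n. (cmod (v j))\<^sup>2)"

definition cmat_norm :: "nat \<Rightarrow> nat \<Rightarrow> (nat \<Rightarrow> nat \<Rightarrow> complex) \<Rightarrow> real" where
  "cmat_norm k n X = Sup {vnorm k (\<lambda>i. \<Sum>j<n. X i j * v j) | v. vnorm n v \<le> 1}"

definition star_vector_space :: "(complex \<Rightarrow> 'v::ab_group_add \<Rightarrow> 'v) \<Rightarrow> ('v \<Rightarrow> 'v) \<Rightarrow> bool" where
  "star_vector_space sc st \<longleftrightarrow> vector_space sc \<and>
     (\<forall>a x y. st (sc a x + y) = sc (cnj a) (st x) + st y) \<and> (\<forall>x. st (st x) = x)"

definition operator_space :: "(complex \<Rightarrow> 'v::ab_group_add \<Rightarrow> 'v) \<Rightarrow> (nat \<Rightarrow> nat \<Rightarrow> (nat \<Rightarrow> nat \<Rightarrow> 'v) \<Rightarrow> real) \<Rightarrow> bool" where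
  "operator_space sc nrm \<longleftrightarrow> vector_space sc \<and>
     (\<forall>n m. 1 \<le> n \<longrightarrow> 1 \<le> m \<longrightarrow>
        (\<forall>A\<in>mats n m. 0 \<le> nrm n m A \<and> (nrm n m A = 0 \<longleftrightarrow> A = (\<lambda>i j. 0))) \<and>
        (\<forall>A\<in>mats n m. \<forall>c. nrm n m (mscale sc c A) = cmod c * nrm n m A) \<and>
        (\<forall>A\<in>mats n m. \<forall>B\<in>mats n m. nrm n m (\<lambda>i j. A i j + B i j) \<le> nrm n m A + nrm n m B)) \<and>
     (\<forall>k n m l X A Y. 1 \<le> k \<longrightarrow> 1 \<le> n \<longrightarrow> 1 \<le> m \<longrightarrow> 1 \<le> l \<longrightarrow> A \<in> mats n m \<longrightarrow>
        nrm k l (smul3 sc k n m l X A Y) \<le> cmat_norm k n X * nrm n m A * cmat_norm m l Y) \<and>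
     (\<forall>n m p q A B. 1 \<le> n \<longrightarrow> 1 \<le> m \<longrightarrow> 1 \<le> p \<longrightarrow> 1 \<le> q \<longrightarrow>
        A \<in> mats n m \<longrightarrow> B \<in> mats p q \<longrightarrow>
        nrm (n + p) (m + q) (dsum n m A B) = max (nrm n m A) (nrm p q B))"

definition star_operator_space ::
  "(complex \<Rightarrow> 'v::ab_group_add \<Rightarrow> 'v) \<Rightarrow> ('v \<Rightarrow> 'v) \<Rightarrow> (nat \<Rightarrow> nat \<Rightarrow> (nat \<Rightarrow> nat \<Rightarrow> 'v) \<Rightarrow> real) \<Rightarrow> bool" where
  "star_operator_space sc st nrm \<longleftrightarrow> operator_space sc nrm \<and> star_vector_space sc st \<and>
     (\<forall>n m. 1 \<le> n \<longrightarrow> 1 \<le> m \<longrightarrow> (\<forall>A\<in>mats n m. nrm m n (mstar st A) = nrm n m A))"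

definition sa_mats :: "('v::zero \<Rightarrow> 'v) \<Rightarrow> nat \<Rightarrow> (nat \<Rightarrow> nat \<Rightarrow> 'v) set" where
  "sa_mats st n = {A \<in> mats n n. mstar st A = A}"

definition proper_cone :: "(complex \<Rightarrow> 'v::ab_group_add \<Rightarrow> 'v) \<Rightarrow> (nat \<Rightarrow> nat \<Rightarrow> 'v) set \<Rightarrow> bool" where
  "proper_cone sc C \<longleftrightarrow> (\<lambda>i j. 0) \<in> C \<and> (\<forall>A\<in>C. \<forall>B\<in>C. (\<lambda>i j. A i j + B i j) \<in> C) \<and>
     (\<forall>A\<in>C. \<forall>t::real. 0 \<le> t \<longrightarrow> mscale sc (complex_of_real t) A \<in> C) \<and>
     (\<forall>A\<in>C. (\<lambda>i j. - A i j) \<in> C \<longrightarrow> A = (\<lambda>i j. 0))"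

definition matrix_ordered ::
  "(complex \<Rightarrow> 'v::ab_group_add \<Rightarrow> 'v) \<Rightarrow> ('v \<Rightarrow> 'v) \<Rightarrow> (nat \<Rightarrow> nat \<Rightarrow> (nat \<Rightarrow> nat \<Rightarrow> 'v) \<Rightarrow> real) \<Rightarrow>
   (nat \<Rightarrow> (nat \<Rightarrow> nat \<Rightarrow> 'v) set) \<Rightarrow> bool" where
  "matrix_ordered sc st nrm pos \<longleftrightarrow> star_operator_space sc st nrm \<and>
     (\<forall>n. 1 \<le> n \<longrightarrow> proper_cone sc (pos n) \<and> pos n \<subseteq> sa_mats st n) \<and>
     (\<forall>n k A B. 1 \<le> n \<longrightarrow> 1 \<le> k \<longrightarrow> A \<in> pos n \<longrightarrow> B \<in> pos k \<longrightarrow> dsum n n A B \<in> pos (n + k)) \<and>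
     (\<forall>l k X B. 1 \<le> l \<longrightarrow> 1 \<le> k \<longrightarrow> B \<in> pos k \<longrightarrow> smul3 sc l k k l X B (cstar X) \<in> pos l)"

definition normal_mo_star_opspace ::
  "(complex \<Rightarrow> 'v::ab_group_add \<Rightarrow> 'v) \<Rightarrow> ('v \<Rightarrow> 'v) \<Rightarrow> (nat \<Rightarrow> nat \<Rightarrow> (nat \<Rightarrow> nat \<Rightarrow> 'v) \<Rightarrow> real) \<Rightarrow>
   (nat \<Rightarrow> (nat \<Rightarrow> nat \<Rightarrow> 'v) set) \<Rightarrow> bool" where
  "normal_mo_star_opspace sc st nrm pos \<longleftrightarrow> matrix_ordered sc st nrm pos \<and>
     (\<forall>n. 1 \<le> n \<longrightarrow>
        (\<forall>f B. (\<forall>k. f k \<in> pos n) \<longrightarrow> B \<in> sa_mats st n \<longrightarrow>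
               (\<lambda>k. nrm n n (\<lambda>i j. f k i j - B i j)) \<longlonglongrightarrow> 0 \<longrightarrow> B \<in> pos n) \<and>
        (\<forall>A\<in>sa_mats st n. \<forall>B\<in>sa_mats st n. \<forall>C\<in>sa_mats st n.
           (\<lambda>i j. B i j - A i j) \<in> pos n \<longrightarrow> (\<lambda>i j. C i j - B i j) \<in> pos n \<longrightarrow> nrm n n B \<le> max (nrm n n A) (nrm n n C)))"

definition l2 :: "'i set \<Rightarrow> ('i \<Rightarrow> complex) set" where
  "l2 I = {x. (\<forall>i. i \<notin> I \<longrightarrow> x i = 0) \<and> (\<lambda>i. (cmod (x i))\<^sup>2) summable_on I}"

definition l2inner :: "'i set \<Rightarrow> ('i \<Rightarrow> complex) \<Rightarrow> ('i \<Rightarrow> complex) \<Rightarrow> complex" where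
  "l2inner I x y = infsum (\<lambda>i. x i * cnj (y i)) I"

definition l2norm :: "'i set \<Rightarrow> ('i \<Rightarrow> complex) \<Rightarrow> real" where
  "l2norm I x = sqrt (infsum (\<lambda>i. (cmod (x i))\<^sup>2) I)"

text \<open>Bounded linear operators on l2(I) (only their action on l2(I) is relevant).\<close>
definition bounded_op :: "'i set \<Rightarrow> (('i \<Rightarrow> complex) \<Rightarrow> ('i \<Rightarrow> complex)) \<Rightarrow> bool" where
  "bounded_op I T \<longleftrightarrow> (\<forall>x\<in>l2 I. T x \<in> l2 I) \<and>
     (\<forall>x\<in>l2 I. \<forall>y\<in>l2 I. \<forall>c. T (\<lambda>i. c * x i + y i) = (\<lambda>i. c * T x i + T y i)) \<and>
     (\<exists>K. \<forall>x\<in>l2 I. l2norm I (T x) \<le> K * l2norm I x)"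

definition opmat_apply :: "nat \<Rightarrow> (nat \<Rightarrow> nat \<Rightarrow> (('i \<Rightarrow> complex) \<Rightarrow> ('i \<Rightarrow> complex))) \<Rightarrow>
    (nat \<Rightarrow> 'i \<Rightarrow> complex) \<Rightarrow> (nat \<Rightarrow> 'i \<Rightarrow> complex)" where
  "opmat_apply m T x = (\<lambda>i t. \<Sum>j<m. T i j (x j) t)"

definition hn_norm :: "'i set \<Rightarrow> nat \<Rightarrow> (nat \<Rightarrow> 'i \<Rightarrow> complex) \<Rightarrow> real" where
  "hn_norm I n x = sqrt (\<Sum>j<n. (l2norm I (x j))\<^sup>2)"

definition opmat_norm :: "'i set \<Rightarrow> nat \<Rightarrow> nat \<Rightarrow> (nat \<Rightarrow> nat \<Rightarrow> (('i \<Rightarrow> complex) \<Rightarrow> ('i \<Rightarrow> complex))) \<Rightarrow> real" where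
  "opmat_norm I n m T = Sup {hn_norm I n (opmat_apply m T x) | x.
        (\<forall>j<m. x j \<in> l2 I) \<and> hn_norm I m x \<le> 1}"

definition opmat_pos :: "'i set \<Rightarrow> nat \<Rightarrow> (nat \<Rightarrow> nat \<Rightarrow> (('i \<Rightarrow> complex) \<Rightarrow> ('i \<Rightarrow> complex))) \<Rightarrow> bool" where
  "opmat_pos I n T \<longleftrightarrow> (\<forall>x. (\<forall>j<n. x j \<in> l2 I) \<longrightarrow>
      (let z = (\<Sum>i<n. l2inner I (opmat_apply n T x i) (x i)) in Im z = 0 \<and> 0 \<le> Re z))"

definition linear_into_B :: "(complex \<Rightarrow> 'v::ab_group_add \<Rightarrow> 'v) \<Rightarrow> 'i set \<Rightarrow> ('v \<Rightarrow> (('i \<Rightarrow> complex) \<Rightarrow> ('i \<Rightarrow> complex))) \<Rightarrow> bool" where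
  "linear_into_B sc I \<phi> \<longleftrightarrow> (\<forall>v. bounded_op I (\<phi> v)) \<and>
     (\<forall>a v w. \<forall>x\<in>l2 I. \<phi> (sc a v + w) x = (\<lambda>t. a * \<phi> v x t + \<phi> w x t))"

end

theory Submission
  imports Defs "HOL-Library.Function_Algebras"
begin

text \<open>It suffices to find, for every self-adjoint \<open>A\<close> in \<open>M\<^sub>n(V)\<close>, completely contractive and
  completely positive maps from V to matrix algebras that recover the norm of \<open>A\<close> and detect
  whether \<open>A\<close> is positive; their direct sum acts on \<open>l\<^sup>2\<close> of the set of all matrix coordinates, and
  non-self-adjoint \<open>A\<close> is replaced by the matrix with off-diagonal blocks \<open>A\<close> and \<open>A\<^sup>*\<close>.

  Consider pairs \<open>(h, y)\<close> of a scalar matrix and a matrix over V, and let \<open>gauge (h, y)\<close> be the infimum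
  of all \<open>t \<ge> 0\<close> such that \<open>y \<le> X\<^sup>* x X\<close> and \<open>h + X\<^sup>* X \<le> t\<close> for some scalar \<open>X\<close> and self-adjoint
  contraction \<open>x\<close>. It is sublinear because \<open>X\<^sup>* x X + Y\<^sup>* y Y\<close> is the compression of \<open>x \<oplus> y\<close> by the
  column with entries \<open>X\<close> and \<open>Y\<close>. Normality says that \<open>\<parallel>A\<parallel>\<close> is at most the maximum of \<open>gauge (0, A)\<close>
  and \<open>gauge (0, -A)\<close>, and closedness of the cone says that \<open>gauge (0, -A) = 0\<close> forces \<open>A \<ge> 0\<close>. A
  linear functional below the gauge that attains it at \<open>(0, A)\<close> is a pair \<open>(p, F)\<close> with \<open>F\<close> positive,
  \<open>p(1) \<le> 1\<close> and \<open>F(X\<^sup>* x X) \<le> p(X\<^sup>* X)\<close>. Hence \<open>p\<close> makes \<open>\<complex>\<^sup>n\<close> a semi-inner product space, and the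
  matrix of the form \<open>(a, b) \<mapsto> F(a\<^sup>* v b)\<close> in an orthonormal basis of it is the required map.\<close>

section \<open>Sublinear functionals and the Hahn-Banach theorem\<close>

lemma le_add_cINF:
  fixes f :: "'i \<Rightarrow> real" and g :: "'j \<Rightarrow> real"
  assumes "I \<noteq> {}" "J \<noteq> {}" and le_add: "\<And>i j. i \<in> I \<Longrightarrow> j \<in> J \<Longrightarrow> z \<le> f i + g j"
  shows "z \<le> (INF i\<in>I. f i) + (INF j\<in>J. g j)"
proof -
  have "z - g j \<le> (INF i\<in>I. f i)" if "j \<in> J" for j
    using le_add[OF _ that] by (intro cINF_greatest[OF \<open>I \<noteq> {}\<close>]) (simp add: diff_le_eq)
  then have "z - (INF i\<in>I. f i) \<le> (INF j\<in>J. g j)"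
    by (intro cINF_greatest[OF \<open>J \<noteq> {}\<close>]) (simp add: diff_le_eq add.commute)
  then show ?thesis by simp
qed

lemma le_mult_cINF:
  fixes f :: "'i \<Rightarrow> real"
  assumes "I \<noteq> {}" "0 < c" and le_mult: "\<And>i. i \<in> I \<Longrightarrow> z \<le> c * f i"
  shows "z \<le> c * (INF i\<in>I. f i)"
proof -
  have "z / c \<le> (INF i\<in>I. f i)"
    using le_mult \<open>0 < c\<close> by (intro cINF_greatest[OF \<open>I \<noteq> {}\<close>]) (simp add: field_simps)
  then show ?thesis using \<open>0 < c\<close> by (simp add: field_simps)
qed

locale sublinear_functional = vector_space s
  for s :: "real \<Rightarrow> 'b::ab_group_add \<Rightarrow> 'b" +
  fixes q :: "'b \<Rightarrow> real"
  assumes subadditive: "q (x + y) \<le> q x + q y"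
    and pos_homogeneous: "0 \<le> c \<Longrightarrow> q (s c x) = c * q x"

lemma sublinear_functionalI:
  fixes s :: "real \<Rightarrow> 'b::ab_group_add \<Rightarrow> 'b"
  assumes "vector_space s"
    and subadditive: "\<And>x y. q (x + y) \<le> q x + q y"
    and scale_le: "\<And>c x. 0 < c \<Longrightarrow> q (s c x) \<le> c * q x"
    and zero: "q 0 = 0"
  shows "sublinear_functional s q"
proof -
  interpret vector_space s by fact
  show ?thesis
  proof unfold_locales
    show "q (s c x) = c * q x" if "0 \<le> c" for c x
    proof (cases "c = 0")
      case True
      then show ?thesis using zero by simp
    next
      case False
      then have "0 < c" using that by simp
      then have "c * q x \<le> q (s c x)"
        using scale_le[of "1 / c" "s c x"] by (simp add: field_simps)
      then show ?thesis using scale_le[OF \<open>0 < c\<close>, of x] by simp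
    qed
  qed (fact subadditive)
qed

context sublinear_functional
begin

lemma zero: "q 0 = 0"
  using pos_homogeneous[of 0 0] by simp

lemma uminus_le: "- q (- x) \<le> q x"
  using subadditive[of x "- x"] zero by simp

definition lowered :: "'b \<Rightarrow> 'b \<Rightarrow> real" where
  "lowered a x = (INF t\<in>{0..}. q (x + s t a) - t * q a)"

lemma lowered_le:
  assumes "0 \<le> t"
  shows "lowered a x \<le> q (x + s t a) - t * q a"
proof -
  have "- q (- x) \<le> q (x + s u a) - u * q a" if "0 \<le> u" for u
    using subadditive[of "x + s u a" "- x"] pos_homogeneous[OF that, of a] by simp
  then show ?thesis
    unfolding lowered_def using assms by (intro cINF_lower bdd_belowI2) auto
qed

lemma lowered_le_self: "lowered a x \<le> q x"
  using lowered_le[of 0] by simp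

lemma lowered_uminus_le: "lowered a (- a) \<le> - q a"
  using lowered_le[of 1 a "- a"] zero by simp

lemma sublinear_functional_lowered: "sublinear_functional s (lowered a)"
proof (rule sublinear_functionalI)
  show "lowered a (x + y) \<le> lowered a x + lowered a y" for x y
    unfolding lowered_def[of a x] lowered_def[of a y]
  proof (rule le_add_cINF)
    fix t u :: real assume "t \<in> {0..}" "u \<in> {0..}"
    then have "lowered a (x + y) \<le> q (x + y + s (t + u) a) - (t + u) * q a"
      by (intro lowered_le) auto
    also have "x + y + s (t + u) a = (x + s t a) + (y + s u a)"
      by (simp add: scale_left_distrib algebra_simps)
    also have "q \<dots> - (t + u) * q a \<le> (q (x + s t a) - t * q a) + (q (y + s u a) - u * q a)"
      using subadditive[of "x + s t a" "y + s u a"] by (simp add: algebra_simps)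
    finally show "lowered a (x + y) \<le> (q (x + s t a) - t * q a) + (q (y + s u a) - u * q a)" .
  qed auto
  show "lowered a (s c x) \<le> c * lowered a x" if "0 < c" for c x
    unfolding lowered_def[of a x]
  proof (rule le_mult_cINF[OF _ that])
    fix t :: real assume "t \<in> {0..}"
    then have "lowered a (s c x) \<le> q (s c x + s (c * t) a) - c * t * q a"
      using that by (intro lowered_le) auto
    also have "s c x + s (c * t) a = s c (x + s t a)"
      by (simp add: scale_right_distrib)
    also have "q \<dots> - c * t * q a = c * (q (x + s t a) - t * q a)"
      using that by (simp add: pos_homogeneous right_diff_distrib)
    finally show "lowered a (s c x) \<le> c * (q (x + s t a) - t * q a)" .
  qed auto
  have "0 \<le> lowered a 0"
    unfolding lowered_def by (rule cINF_greatest) (simp_all add: pos_homogeneous)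
  then show "lowered a 0 = 0" using lowered_le_self[of a 0] zero by simp
qed (fact vector_space_axioms)

text \<open>A minimal sublinear functional equals all its lowerings, hence is odd.\<close>
lemma linear_if_minimal:
  assumes minimal: "\<And>f. sublinear_functional s f \<Longrightarrow> f \<le> q \<Longrightarrow> f = q"
  shows "Vector_Spaces.linear s (*) q"
proof -
  have "lowered a = q" for a
    by (intro minimal sublinear_functional_lowered) (simp add: le_fun_def lowered_le_self)
  then have odd: "q (- x) = - q x" for x
    using lowered_uminus_le[of x] uminus_le[of x] by simp
  have "q (x + y) = q x + q y" for x y
    using subadditive[of x y] subadditive[of "x + y" "- y"] odd[of y] by simp
  moreover have "q (s c x) = c * q x" for c x
  proof (cases "0 \<le> c")
    case False
    then have "q (- s (- c) x) = c * q x"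
      using odd[of "s (- c) x"] pos_homogeneous[of "- c" x] by simp
    then show ?thesis by simp
  qed (rule pos_homogeneous)
  ultimately show ?thesis
    unfolding Vector_Spaces.linear_iff
    by (intro conjI allI vector_space_axioms vector_space_over_itself.vector_space_axioms)
qed

lemma INF_sublinear_le:
  assumes sublinear: "\<And>f. f \<in> C \<Longrightarrow> sublinear_functional s f" and below: "\<And>f. f \<in> C \<Longrightarrow> f \<le> q"
    and "f \<in> C"
  shows "(INF f\<in>C. f x) \<le> f x"
proof (rule cINF_lower[OF bdd_belowI2 \<open>f \<in> C\<close>])
  fix g assume g: "g \<in> C"
  show "- q (- x) \<le> g x"
    using sublinear_functional.uminus_le[OF sublinear[OF g], of x] le_funD[OF below[OF g], of "- x"]
    by linarith
qed

lemma sublinear_functional_INF_chain: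
  assumes "C \<noteq> {}"
    and sublinear: "\<And>f. f \<in> C \<Longrightarrow> sublinear_functional s f"
    and below: "\<And>f. f \<in> C \<Longrightarrow> f \<le> q"
    and chain: "\<And>f g. f \<in> C \<Longrightarrow> g \<in> C \<Longrightarrow> f \<le> g \<or> g \<le> f"
  shows "sublinear_functional s (\<lambda>x. INF f\<in>C. f x)"
proof (rule sublinear_functionalI)
  note INF_le = INF_sublinear_le[OF sublinear below]
  show "(INF f\<in>C. f (x + y)) \<le> (INF f\<in>C. f x) + (INF f\<in>C. f y)" for x y
  proof (rule le_add_cINF[OF \<open>C \<noteq> {}\<close> \<open>C \<noteq> {}\<close>])
    fix f g assume "f \<in> C" "g \<in> C"
    then obtain h where h: "h \<in> C" "h \<le> f" "h \<le> g" using chain by blast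
    have "(INF f\<in>C. f (x + y)) \<le> h (x + y)" by (rule INF_le[OF _ _ h(1)])
    also have "\<dots> \<le> h x + h y" by (rule sublinear_functional.subadditive[OF sublinear[OF h(1)]])
    also have "\<dots> \<le> f x + g y" using h by (intro add_mono) (simp_all add: le_fun_def)
    finally show "(INF f\<in>C. f (x + y)) \<le> f x + g y" .
  qed
  show "(INF f\<in>C. f (s c x)) \<le> c * (INF f\<in>C. f x)" if "0 < c" for c x
  proof (rule le_mult_cINF[OF \<open>C \<noteq> {}\<close> that])
    fix f assume f: "f \<in> C"
    have "(INF f\<in>C. f (s c x)) \<le> f (s c x)" by (rule INF_le[OF _ _ f])
    also have "\<dots> = c * f x"
      using sublinear_functional.pos_homogeneous[OF sublinear[OF f]] that by simp
    finally show "(INF f\<in>C. f (s c x)) \<le> c * f x" .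
  qed
  have "(\<lambda>f. f 0) ` C = {0}"
    using sublinear_functional.zero[OF sublinear] \<open>C \<noteq> {}\<close> by force
  then show "(INF f\<in>C. f 0) = 0" by simp
qed (fact vector_space_axioms)

lemma minimal_sublinear_functional_exists:
  obtains m where "sublinear_functional s m" "m \<le> q"
    "\<And>f. sublinear_functional s f \<Longrightarrow> f \<le> m \<Longrightarrow> f = m"
proof -
  define A where "A = {f. sublinear_functional s f \<and> f \<le> q}"
  have "\<exists>m\<in>A. \<forall>f\<in>A. m \<ge> f \<longrightarrow> f = m"
  proof (rule predicate_Zorn)
    show "partial_order_on A (relation_of (\<ge>) A)"
      by (rule partial_order_on_relation_ofI) auto
  next
    fix C assume "C \<in> Chains (relation_of (\<ge>) A)"
    then have CA: "C \<subseteq> A" and chain: "\<And>f g. f \<in> C \<Longrightarrow> g \<in> C \<Longrightarrow> f \<le> g \<or> g \<le> f"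
      unfolding Chains_def relation_of_def by auto
    show "\<exists>u\<in>A. \<forall>f\<in>C. f \<ge> u"
    proof (cases "C = {}")
      case True
      then show ?thesis unfolding A_def using sublinear_functional_axioms by blast
    next
      case False
      then obtain g where g: "g \<in> C" by blast
      have C: "sublinear_functional s f" "f \<le> q" if "f \<in> C" for f
        using CA that unfolding A_def by auto
      have "sublinear_functional s (\<lambda>x. INF f\<in>C. f x)"
        by (rule sublinear_functional_INF_chain[OF False C chain])
      moreover have lower: "(\<lambda>x. INF f\<in>C. f x) \<le> f" if "f \<in> C" for f
        by (rule le_funI) (rule INF_sublinear_le[OF C that])
      moreover have "(\<lambda>x. INF f\<in>C. f x) \<le> q"
        using lower[OF g] C(2)[OF g] by (rule order_trans)
      ultimately show ?thesis unfolding A_def by blast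
    qed
  qed
  then obtain m where m: "m \<in> A" "\<And>f. f \<in> A \<Longrightarrow> f \<le> m \<Longrightarrow> f = m" by blast
  show ?thesis
  proof (rule that[of m])
    show "sublinear_functional s m" "m \<le> q" using m(1) unfolding A_def by auto
    show "f = m" if "sublinear_functional s f" "f \<le> m" for f
      using that m(1) by (intro m(2)) (auto simp: A_def intro: order_trans)
  qed
qed

theorem hahn_banach:
  obtains f where "Vector_Spaces.linear s (*) f" "f \<le> q" "f a = q a"
proof -
  interpret lowered: sublinear_functional s "lowered a"
    by (rule sublinear_functional_lowered)
  obtain f where f: "sublinear_functional s f" "f \<le> lowered a"
    and minimal: "\<And>g. sublinear_functional s g \<Longrightarrow> g \<le> f \<Longrightarrow> g = f"
    using lowered.minimal_sublinear_functional_exists by blast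
  have lin: "Vector_Spaces.linear s (*) f"
    using sublinear_functional.linear_if_minimal[OF f(1) minimal] .
  interpret f: Vector_Spaces.linear s "(*)" f by (rule lin)
  have below: "f \<le> q" using f(2) lowered_le_self by (auto simp: le_fun_def intro: order_trans)
  have "f (- a) \<le> - q a" using f(2) lowered_uminus_le[of a]
    by (auto simp: le_fun_def intro: order_trans)
  then have "f a = q a" using le_funD[OF below, of a] by (simp add: f.neg)
  then show ?thesis using that lin below by blast
qed

end

lemma vector_space_of_real_scale:
  fixes sc :: "complex \<Rightarrow> 'b::ab_group_add \<Rightarrow> 'b"
  assumes "vector_space sc"
  shows "vector_space (\<lambda>r. sc (complex_of_real r))"
proof -
  interpret vector_space sc by fact
  show ?thesis by unfold_locales (simp_all add: scale_left_distrib scale_right_distrib)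
qed

lemma linear_complexification:
  fixes sc :: "complex \<Rightarrow> 'b::ab_group_add \<Rightarrow> 'b"
  assumes "vector_space sc" and "Vector_Spaces.linear (\<lambda>r. sc (complex_of_real r)) (*) f"
  shows "Vector_Spaces.linear sc (*) (\<lambda>x. Complex (f x) (- f (sc \<i> x)))"
proof -
  interpret vector_space sc by fact
  interpret f: Vector_Spaces.linear "\<lambda>r. sc (complex_of_real r)" "(*)" f by fact
  have f_scale: "f (sc c x) = Re c * f x + Im c * f (sc \<i> x)" for c x
  proof -
    have "sc c x = sc (complex_of_real (Re c)) x + sc (complex_of_real (Im c)) (sc \<i> x)"
      by (simp add: scale_left_distrib[symmetric] complex_eq_iff)
    then show ?thesis by (simp only: f.add f.scale)
  qed
  have "f (sc \<i> (sc c x)) = Re c * f (sc \<i> x) - Im c * f x" for c x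
    using f_scale[of "\<i> * c" x] by simp
  then have "Complex (f (sc c x)) (- f (sc \<i> (sc c x))) = c * Complex (f x) (- f (sc \<i> x))" for c x
    unfolding f_scale[of c x] by (simp add: complex_eq_iff)
  moreover have "Complex (f (x + y)) (- f (sc \<i> (x + y)))
      = Complex (f x) (- f (sc \<i> x)) + Complex (f y) (- f (sc \<i> y))" for x y
    by (simp add: f.add scale_right_distrib complex_eq_iff)
  ultimately show ?thesis
    unfolding Vector_Spaces.linear_iff
    by (intro conjI allI vector_space_axioms vector_space_over_itself.vector_space_axioms)
qed

section \<open>Sesquilinear forms and Gram-Schmidt orthonormalization\<close>

locale sesquilinear_form = vector_space scale
  for scale :: "complex \<Rightarrow> 'b::ab_group_add \<Rightarrow> 'b" +
  fixes S :: "'b \<Rightarrow> 'b \<Rightarrow> complex"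
  assumes add_left: "S (a + a') b = S a b + S a' b"
    and add_right: "S a (b + b') = S a b + S a b'"
    and scale_left: "S (scale c a) b = cnj c * S a b"
    and scale_right: "S a (scale c b) = c * S a b"
begin

lemma zero_left [simp]: "S 0 b = 0"
  using scale_left[of 0 0 b] by simp

lemma zero_right [simp]: "S a 0 = 0"
  using scale_right[of a 0 0] by simp

lemma diff_left: "S (a - a') b = S a b - S a' b"
  using add_left[of "a - a'" a' b] by simp

lemma diff_right: "S a (b - b') = S a b - S a b'"
  using add_right[of a "b - b'" b'] by simp

lemma sum_left: "S (\<Sum>r\<in>I. scale (c r) (u r)) b = (\<Sum>r\<in>I. cnj (c r) * S (u r) b)"
  by (induction I rule: infinite_finite_induct) (simp_all add: add_left scale_left)

lemma sum_right: "S a (\<Sum>r\<in>I. scale (c r) (u r)) = (\<Sum>r\<in>I. c r * S a (u r))"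
  by (induction I rule: infinite_finite_induct) (simp_all add: add_right scale_right)

end

locale semi_inner_product = sesquilinear_form scale P
  for scale :: "complex \<Rightarrow> 'b::ab_group_add \<Rightarrow> 'b" and P +
  assumes cnj_commute: "cnj (P a b) = P b a"
    and nonneg: "0 \<le> Re (P a a)"
begin

lemma Im_self [simp]: "Im (P a a) = 0"
  using cnj_commute[of a a] by (simp add: complex_eq_iff)

definition sq_sum :: "nat \<Rightarrow> (nat \<Rightarrow> 'b) \<Rightarrow> real" where
  "sq_sum k a = (\<Sum>p<k. Re (P (a p) (a p)))"

lemma sq_sum_nonneg: "0 \<le> sq_sum k a"
  unfolding sq_sum_def by (intro sum_nonneg nonneg)

definition null :: "'b \<Rightarrow> bool" where
  "null z \<longleftrightarrow> P z z = 0"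

lemma null_left:
  assumes "null z"
  shows "P z x = 0"
proof (rule ccontr)
  define w where "w = P z x"
  assume "P z x \<noteq> 0"
  then have w: "w * cnj w = of_real ((cmod w)\<^sup>2)" "cmod w \<noteq> 0"
    unfolding w_def by (simp_all add: complex_norm_square del: of_real_power)
  define c where "c = - of_real ((Re (P x x) + 1) / (cmod w)\<^sup>2) * w"
  have "cnj c * w = - of_real (Re (P x x) + 1)"
    using w unfolding c_def by (simp add: field_simps)
  moreover have "P (x + scale c z) (x + scale c z) = P x x + (cnj c * w + cnj (cnj c * w))"
    using assms cnj_commute[of z x] unfolding w_def null_def
    by (simp add: add_left add_right scale_left scale_right)
  ultimately have "Re (P (x + scale c z) (x + scale c z)) = - Re (P x x) - 2" by simp
  then show False using nonneg[of "x + scale c z"] nonneg[of x] by simp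
qed

lemma null_right: "null z \<Longrightarrow> P x z = 0"
  using null_left[of z x] cnj_commute[of z x] by simp

definition orthonormal :: "nat \<Rightarrow> (nat \<Rightarrow> 'b) \<Rightarrow> bool" where
  "orthonormal d u \<longleftrightarrow> (\<forall>r<d. \<forall>s<d. P (u r) (u s) = of_bool (r = s))"

definition residual :: "nat \<Rightarrow> (nat \<Rightarrow> 'b) \<Rightarrow> 'b \<Rightarrow> 'b" where
  "residual d u x = x - (\<Sum>r<d. scale (P (u r) x) (u r))"

lemma residual_orthogonal:
  assumes "orthonormal d u" "s < d"
  shows "P (u s) (residual d u x) = 0"
proof -
  have "(\<Sum>r<d. P (u r) x * P (u s) (u r)) = (\<Sum>r<d. if s = r then P (u r) x else 0)"
    using assms unfolding orthonormal_def by (intro sum.cong refl) auto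
  then show ?thesis using \<open>s < d\<close> by (simp add: residual_def diff_right sum_right)
qed

lemma parseval:
  assumes "orthonormal d u"
  shows "P (\<Sum>r<d. scale (c r) (u r)) (\<Sum>r<d. scale (c r) (u r)) = of_real (\<Sum>r<d. (cmod (c r))\<^sup>2)"
proof -
  have "(\<Sum>s<d. cnj (c s) * P (u s) (u r)) = cnj (c r)" if "r < d" for r
  proof -
    have "(\<Sum>s<d. cnj (c s) * P (u s) (u r)) = (\<Sum>s<d. if s = r then cnj (c s) else 0)"
      using assms that unfolding orthonormal_def by (intro sum.cong refl) auto
    then show ?thesis using that by simp
  qed
  then show ?thesis
    unfolding sum_right sum_left of_real_sum complex_norm_square by simp
qed

lemma bessel_ineq:
  assumes "orthonormal d u"
  shows "(\<Sum>r<d. (cmod (P (u r) x))\<^sup>2) \<le> Re (P x x)"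
proof -
  have "P (residual d u x) y = P x y - (\<Sum>r<d. cnj (P (u r) x) * P (u r) y)" for y
    unfolding residual_def diff_left sum_left ..
  then have "P (residual d u x) (residual d u x) = P x (residual d u x)"
    by (simp add: residual_orthogonal[OF assms])
  also have "\<dots> = P x x - (\<Sum>r<d. of_real ((cmod (P (u r) x))\<^sup>2))"
    unfolding residual_def diff_right sum_right complex_norm_square by (simp add: cnj_commute)
  finally have "Re (P (residual d u x) (residual d u x))
      = Re (P x x) - (\<Sum>r<d. (cmod (P (u r) x))\<^sup>2)"
    by simp
  then show ?thesis using nonneg[of "residual d u x"] by simp
qed

lemma orthonormal_extend:
  assumes "orthonormal d u" "P v v = 1" "\<And>s. s < d \<Longrightarrow> P (u s) v = 0"
  shows "orthonormal (Suc d) (u(d := v))"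
proof -
  have "P v (u s) = 0" if "s < d" for s
    using assms(3)[OF that] cnj_commute[of "u s" v] by simp
  then show ?thesis using assms unfolding orthonormal_def by (auto simp: less_Suc_eq)
qed

lemma residual_extend:
  assumes "\<And>s. s < d \<Longrightarrow> P (u s) v = 0"
  shows "residual (Suc d) (u(d := v)) x = residual d u x - scale (P v (residual d u x)) v"
proof -
  have "P v (u s) = 0" if "s < d" for s
    using assms[OF that] cnj_commute[of "u s" v] by simp
  then have "P v (residual d u x) = P v x"
    unfolding residual_def diff_right sum_right by simp
  then show ?thesis unfolding residual_def by (simp add: algebra_simps)
qed

text \<open>A null residual does not contribute to the basis; otherwise it is normalized and appended.\<close>
lemma gram_schmidt_step:
  assumes "orthonormal d u"
  obtains d' u' where "orthonormal d' u'" "null (residual d' u' x)"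
    "\<And>y. null (residual d u y) \<Longrightarrow> residual d' u' y = residual d u y"
proof (cases "null (residual d u x)")
  case True
  then show ?thesis using that assms by blast
next
  case False
  define w where "w = residual d u x"
  define c where "c = sqrt (Re (P w w))"
  define v where "v = scale (of_real (1 / c)) w"
  have "0 < Re (P w w)"
    using False nonneg[of w] unfolding w_def null_def by (simp add: complex_eq_iff)
  then have c: "0 < c" "P w w = of_real (c * c)"
    unfolding c_def by (simp_all add: complex_eq_iff)
  then have normalized: "P v v = 1" "P v w = of_real c"
    unfolding v_def by (simp_all add: scale_left scale_right)
  have orth: "P (u s) v = 0" if "s < d" for s
    using residual_orthogonal[OF assms that, of x] unfolding v_def w_def by (simp add: scale_right)
  show ?thesis
  proof (rule that)
    show "orthonormal (Suc d) (u(d := v))"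
      using orthonormal_extend[OF assms normalized(1) orth] .
    have "residual (Suc d) (u(d := v)) x = w - scale (of_real c) v"
      using residual_extend[of d u v x] orth normalized(2) unfolding w_def by simp
    also have "\<dots> = 0" unfolding v_def using c(1) by simp
    finally show "null (residual (Suc d) (u(d := v)) x)" by (simp add: null_def)
    show "residual (Suc d) (u(d := v)) y = residual d u y"
      if "null (residual d u y)" for y
      using residual_extend[of d u v y] orth null_right[OF that, of v] by simp
  qed
qed

lemma gram_schmidt:
  fixes n :: nat
  shows "\<exists>d u. orthonormal d u \<and> (\<forall>i<n. null (residual d u (e i)))"
proof (induction n)
  case 0
  have "orthonormal 0 e" by (simp add: orthonormal_def)
  then show ?case by blast
next
  case (Suc n)
  then obtain d u where u: "orthonormal d u" "\<And>i. i < n \<Longrightarrow> null (residual d u (e i))"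
    by blast
  obtain d' u' where "orthonormal d' u'" "null (residual d' u' (e n))"
    "\<And>y. null (residual d u y) \<Longrightarrow> residual d' u' y = residual d u y"
    using gram_schmidt_step[OF u(1), of "e n"] by blast
  then show ?case using u(2) by (metis less_Suc_eq)
qed

end

section \<open>Finite vectors and scalar matrices\<close>

lemma le_sqrt_mult_sqrt:
  fixes S T z :: real
  assumes "0 \<le> S" "0 \<le> T" and weighted: "\<And>r. 0 < r \<Longrightarrow> 2 * z \<le> r * S + T / r"
  shows "z \<le> sqrt S * sqrt T"
proof (rule tendsto_lowerbound)
  show "((\<lambda>e. sqrt (S + e) * sqrt (T + e)) \<longlongrightarrow> sqrt S * sqrt T) (at_right 0)"
    by (auto intro!: tendsto_eq_intros)
  have "z \<le> sqrt (S + e) * sqrt (T + e)" if "0 < e" for e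
  proof -
    define a where "a = sqrt (S + e)"
    define b where "b = sqrt (T + e)"
    have roots: "0 < a" "0 < b" "S \<le> a * a" "T \<le> b * b"
      using assms that unfolding a_def b_def by simp_all
    have "2 * z \<le> b / a * S + T / (b / a)" using weighted[of "b / a"] roots by simp
    also have "\<dots> \<le> b / a * (a * a) + (b * b) / (b / a)"
      using roots by (intro add_mono mult_left_mono divide_right_mono) auto
    also have "\<dots> = 2 * (a * b)" using roots by simp
    finally show ?thesis unfolding a_def b_def by simp
  qed
  then show "\<forall>\<^sub>F e in at_right 0. z \<le> sqrt (S + e) * sqrt (T + e)"
    by (rule eventually_mono[OF eventually_at_right_less])
qed simp

lemma sum_lessThan_add:
  fixes f :: "nat \<Rightarrow> 'a::comm_monoid_add"
  shows "(\<Sum>p<a + b. f p) = (\<Sum>p<a. f p) + (\<Sum>p<b. f (a + p))"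
  by (induction b) (simp_all add: add.assoc)

lemma sum_fun_apply: "(\<Sum>i\<in>I. f i) x = (\<Sum>i\<in>I. f i x)"
  by (induction I rule: infinite_finite_induct) simp_all

lemma vnorm_eq_L2_set: "vnorm n v = L2_set (\<lambda>i. cmod (v i)) {..<n}"
  unfolding vnorm_def L2_set_def ..

lemma vnorm_nonneg [simp]: "0 \<le> vnorm n v"
  by (simp add: vnorm_eq_L2_set)

lemma vnorm_cnj [simp]: "vnorm n (\<lambda>i. cnj (v i)) = vnorm n v"
  by (simp add: vnorm_def)

lemma vnorm_sq: "(vnorm n v)\<^sup>2 = (\<Sum>i<n. (cmod (v i))\<^sup>2)"
  unfolding vnorm_def by (simp add: sum_nonneg)

lemma cmod_sum_mult_le_vnorm: "cmod (\<Sum>i<n. f i * g i) \<le> vnorm n f * vnorm n g"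
proof -
  have "cmod (\<Sum>i<n. f i * g i) \<le> (\<Sum>i<n. \<bar>cmod (f i)\<bar> * \<bar>cmod (g i)\<bar>)"
    by (rule order_trans[OF norm_sum]) (simp add: norm_mult)
  also have "\<dots> \<le> vnorm n f * vnorm n g"
    unfolding vnorm_eq_L2_set by (rule L2_set_mult_ineq)
  finally show ?thesis .
qed

definition cmat_apply :: "nat \<Rightarrow> (nat \<Rightarrow> nat \<Rightarrow> complex) \<Rightarrow> (nat \<Rightarrow> complex) \<Rightarrow> nat \<Rightarrow> complex" where
  "cmat_apply n X v = (\<lambda>i. \<Sum>j<n. X i j * v j)"

definition frobenius_norm :: "nat \<Rightarrow> nat \<Rightarrow> (nat \<Rightarrow> nat \<Rightarrow> complex) \<Rightarrow> real" where
  "frobenius_norm k n X = L2_set (\<lambda>i. vnorm n (X i)) {..<k}"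

lemma frobenius_norm_nonneg: "0 \<le> frobenius_norm k n X"
  by (simp add: frobenius_norm_def)

lemma vnorm_cmat_apply_le_frobenius: "vnorm k (cmat_apply n X v) \<le> frobenius_norm k n X * vnorm n v"
proof -
  have "vnorm k (cmat_apply n X v) \<le> L2_set (\<lambda>i. vnorm n (X i) * vnorm n v) {..<k}"
    unfolding vnorm_eq_L2_set[of k] cmat_apply_def
    by (intro L2_set_mono cmod_sum_mult_le_vnorm) simp
  also have "\<dots> = frobenius_norm k n X * vnorm n v"
    by (simp add: frobenius_norm_def L2_set_left_distrib)
  finally show ?thesis .
qed

text \<open>The bound also ensures that the supremum defining the norm is taken over a bounded set.\<close>
lemma cmat_norm_bounds:
  assumes "0 \<le> c" and bounded: "\<And>v. vnorm k (cmat_apply n X v) \<le> c * vnorm n v"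
  shows "cmat_norm k n X \<le> c" "0 \<le> cmat_norm k n X"
proof -
  define S where "S = {vnorm k (cmat_apply n X v) | v. vnorm n v \<le> 1}"
  have norm: "cmat_norm k n X = Sup S"
    unfolding cmat_norm_def S_def cmat_apply_def ..
  have "vnorm k (cmat_apply n X 0) \<in> S"
    unfolding S_def by (intro CollectI exI[of _ 0]) (simp add: vnorm_def)
  then have zero: "0 \<in> S" by (simp add: vnorm_def cmat_apply_def)
  have upper: "u \<le> c" if "u \<in> S" for u
  proof -
    obtain v where v: "u = vnorm k (cmat_apply n X v)" "vnorm n v \<le> 1"
      using \<open>u \<in> S\<close> unfolding S_def by blast
    then have "u \<le> c * 1" using bounded[of v] mult_left_mono[OF v(2) \<open>0 \<le> c\<close>] by linarith
    then show ?thesis by simp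
  qed
  show "cmat_norm k n X \<le> c" unfolding norm using zero upper by (intro cSup_least) auto
  show "0 \<le> cmat_norm k n X" unfolding norm using zero upper by (intro cSup_upper bdd_aboveI) auto
qed

lemma cmat_apply_cstar_adjoint:
  "(\<Sum>i<n. cnj (w i) * cmat_apply k (cstar X) v i) = (\<Sum>p<k. cnj (cmat_apply n X w p) * v p)"
proof -
  have "(\<Sum>i<n. cnj (w i) * cmat_apply k (cstar X) v i) = (\<Sum>i<n. \<Sum>p<k. cnj (X p i * w i) * v p)"
    by (simp add: cmat_apply_def cstar_def sum_distrib_left ac_simps)
  also have "\<dots> = (\<Sum>p<k. \<Sum>i<n. cnj (X p i * w i) * v p)"
    by (rule sum.swap)
  also have "\<dots> = (\<Sum>p<k. cnj (cmat_apply n X w p) * v p)"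
    by (simp add: cmat_apply_def sum_distrib_right)
  finally show ?thesis .
qed

lemma vnorm_cstar_apply_le:
  assumes "0 \<le> c" and bounded: "\<And>w. vnorm k (cmat_apply n X w) \<le> c * vnorm n w"
  shows "vnorm n (cmat_apply k (cstar X) v) \<le> c * vnorm k v"
proof -
  define w where "w = cmat_apply k (cstar X) v"
  have "complex_of_real ((vnorm n w)\<^sup>2) = (\<Sum>i<n. cnj (w i) * w i)"
    unfolding vnorm_sq of_real_sum complex_norm_square by (simp add: mult.commute)
  also have "\<dots> = (\<Sum>p<k. cnj (cmat_apply n X w p) * v p)"
    unfolding w_def by (rule cmat_apply_cstar_adjoint)
  finally have "(vnorm n w)\<^sup>2 = cmod (\<Sum>p<k. cnj (cmat_apply n X w p) * v p)"
    by (metis abs_power2 norm_of_real)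
  also have "\<dots> \<le> vnorm k (\<lambda>p. cnj (cmat_apply n X w p)) * vnorm k v"
    by (rule cmod_sum_mult_le_vnorm)
  also have "\<dots> \<le> c * vnorm n w * vnorm k v"
    using bounded[of w] by (simp add: mult_right_mono)
  finally have "vnorm n w * vnorm n w \<le> vnorm n w * (c * vnorm k v)"
    by (simp add: power2_eq_square ac_simps)
  then have "vnorm n w \<le> c * vnorm k v"
    using \<open>0 \<le> c\<close> by (cases "vnorm n w = 0") (simp_all add: mult_le_cancel_left less_le)
  then show ?thesis unfolding w_def .
qed

definition matrix_form :: "nat \<Rightarrow> (nat \<Rightarrow> nat \<Rightarrow> complex) \<Rightarrow> (nat \<Rightarrow> complex) \<Rightarrow> (nat \<Rightarrow> complex)
    \<Rightarrow> complex" where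
  "matrix_form n h a b = (\<Sum>i<n. cnj (a i) * cmat_apply n h b i)"

lemma cmod_matrix_form_le:
  "cmod (matrix_form n h a b) \<le> frobenius_norm n n h * vnorm n a * vnorm n b"
proof -
  have "cmod (matrix_form n h a b) \<le> vnorm n (\<lambda>i. cnj (a i)) * vnorm n (cmat_apply n h b)"
    unfolding matrix_form_def by (rule cmod_sum_mult_le_vnorm)
  also have "\<dots> \<le> vnorm n a * (frobenius_norm n n h * vnorm n b)"
    using vnorm_cmat_apply_le_frobenius[of n n h b] by (simp add: mult_left_mono)
  finally show ?thesis by (simp add: ac_simps)
qed

section \<open>Operator matrices on spaces of square-summable vectors\<close>

definition hn_inner :: "'i set \<Rightarrow> nat \<Rightarrow> (nat \<Rightarrow> 'i \<Rightarrow> complex) \<Rightarrow> (nat \<Rightarrow> 'i \<Rightarrow> complex) \<Rightarrow> complex" where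
  "hn_inner I n x y = (\<Sum>i<n. l2inner I (x i) (y i))"

lemma hn_norm_nonneg [simp]: "0 \<le> hn_norm I n x"
  unfolding hn_norm_def by (simp add: sum_nonneg)

lemma opmat_pos_iff:
  "opmat_pos I n T \<longleftrightarrow> (\<forall>x. (\<forall>j<n. x j \<in> l2 I) \<longrightarrow> 0 \<le> hn_inner I n (opmat_apply n T x) x)"
  unfolding opmat_pos_def hn_inner_def less_eq_complex_def by (auto simp: Let_def)

lemma summable_on_finite_sum:
  fixes f :: "nat \<Rightarrow> 'a \<Rightarrow> 'b::{topological_comm_monoid_add,t2_space}"
  assumes "\<And>i. i < n \<Longrightarrow> f i summable_on S"
  shows "(\<lambda>t. \<Sum>i<n. f i t) summable_on S"
    and "infsum (\<lambda>t. \<Sum>i<n. f i t) S = (\<Sum>i<n. infsum (f i) S)"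
  using assms by (induction n) (simp_all add: summable_on_add infsum_add)

lemma l2_scale: "x \<in> l2 I \<Longrightarrow> (\<lambda>t. a * x t) \<in> l2 I"
  unfolding l2_def by (auto simp: norm_mult power_mult_distrib intro: summable_on_cmult_right)

lemma l2_mult_summable:
  assumes "x \<in> l2 I" "y \<in> l2 I"
  shows "(\<lambda>t. x t * cnj (y t)) summable_on I"
proof (rule abs_summable_summable, rule abs_summable_product)
  show "(\<lambda>t. norm (x t * x t)) summable_on I" "(\<lambda>t. norm (cnj (y t) * cnj (y t))) summable_on I"
    using assms unfolding l2_def by (auto simp: norm_mult power2_eq_square)
qed

lemma
  assumes "\<And>i. i < n \<Longrightarrow> x i \<in> l2 I" "\<And>i. i < n \<Longrightarrow> y i \<in> l2 I"
  shows hn_inner_summable: "(\<lambda>t. \<Sum>i<n. x i t * cnj (y i t)) summable_on I"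
    and hn_inner_eq_infsum: "hn_inner I n x y = infsum (\<lambda>t. \<Sum>i<n. x i t * cnj (y i t)) I"
proof -
  have "(\<lambda>t. x i t * cnj (y i t)) summable_on I" if "i < n" for i
    using assms that by (intro l2_mult_summable)
  then show "(\<lambda>t. \<Sum>i<n. x i t * cnj (y i t)) summable_on I"
    "hn_inner I n x y = infsum (\<lambda>t. \<Sum>i<n. x i t * cnj (y i t)) I"
    using summable_on_finite_sum[of n "\<lambda>i t. x i t * cnj (y i t)" I]
    by (simp_all add: hn_inner_def l2inner_def)
qed

lemma
  assumes "\<And>i. i < n \<Longrightarrow> x i \<in> l2 I"
  shows hn_norm_summable: "(\<lambda>t. \<Sum>i<n. (cmod (x i t))\<^sup>2) summable_on I"
    and hn_norm_sq_eq_infsum: "(hn_norm I n x)\<^sup>2 = infsum (\<lambda>t. \<Sum>i<n. (cmod (x i t))\<^sup>2) I"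
proof -
  have "(\<lambda>t. (cmod (x i t))\<^sup>2) summable_on I" if "i < n" for i
    using assms[OF that] unfolding l2_def by blast
  then show "(\<lambda>t. \<Sum>i<n. (cmod (x i t))\<^sup>2) summable_on I"
    "(hn_norm I n x)\<^sup>2 = infsum (\<lambda>t. \<Sum>i<n. (cmod (x i t))\<^sup>2) I"
    using summable_on_finite_sum[of n "\<lambda>i t. (cmod (x i t))\<^sup>2" I]
    by (simp_all add: hn_norm_def l2norm_def sum_nonneg infsum_nonneg)
qed

lemma l2norm_lessThan: "l2norm {..<d} x = vnorm d x"
  unfolding l2norm_def vnorm_def by simp

lemma hn_norm_lessThan_sq:
  fixes d :: nat
  shows "(hn_norm {..<d} n \<xi>)\<^sup>2 = (\<Sum>i<n. \<Sum>r<d. (cmod (\<xi> i r))\<^sup>2)"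
  by (simp add: hn_norm_def l2norm_lessThan vnorm_sq sum_nonneg)

lemma hn_inner_lessThan:
  fixes d :: nat
  shows "hn_inner {..<d} n x y = (\<Sum>i<n. \<Sum>r<d. x i r * cnj (y i r))"
  unfolding hn_inner_def l2inner_def by simp

lemma hn_inner_self_lessThan:
  fixes d :: nat
  shows "hn_inner {..<d} n x x = of_real ((hn_norm {..<d} n x)\<^sup>2)"
  unfolding hn_inner_lessThan hn_norm_lessThan_sq of_real_sum complex_norm_square ..

lemma cmod_hn_inner_le:
  fixes d :: nat
  shows "cmod (hn_inner {..<d} n x y) \<le> hn_norm {..<d} n x * hn_norm {..<d} n y"
proof -
  have "cmod (hn_inner {..<d} n x y) \<le> (\<Sum>i<n. \<bar>vnorm d (x i)\<bar> * \<bar>vnorm d (y i)\<bar>)"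
    unfolding hn_inner_lessThan
  proof (rule order_trans[OF norm_sum], rule sum_mono)
    show "cmod (\<Sum>r<d. x i r * cnj (y i r)) \<le> \<bar>vnorm d (x i)\<bar> * \<bar>vnorm d (y i)\<bar>" for i
      using cmod_sum_mult_le_vnorm[of "x i" "\<lambda>r. cnj (y i r)" d] by simp
  qed
  also have "\<dots> \<le> L2_set (\<lambda>i. vnorm d (x i)) {..<n} * L2_set (\<lambda>i. vnorm d (y i)) {..<n}"
    by (rule L2_set_mult_ineq)
  finally show ?thesis unfolding hn_norm_def l2norm_lessThan L2_set_def .
qed

lemma zero_l2: "(\<lambda>t. 0) \<in> l2 I"
  unfolding l2_def by simp

lemma hn_norm_zero: "hn_norm I n (\<lambda>i t. 0) = 0"
  unfolding hn_norm_def l2norm_def by simp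

lemma hn_norm_scale: "hn_norm I n (\<lambda>i t. a * x i t) = cmod a * hn_norm I n x"
proof -
  have "l2norm I (\<lambda>t. a * y t) = cmod a * l2norm I y" for y :: "'a \<Rightarrow> complex"
    by (simp add: l2norm_def norm_mult power_mult_distrib infsum_cmult_right' real_sqrt_mult)
  then show ?thesis
    by (simp add: hn_norm_def power_mult_distrib real_sqrt_mult flip: sum_distrib_left)
qed

context
  fixes I :: "'i set" and T :: "nat \<Rightarrow> nat \<Rightarrow> ('i \<Rightarrow> complex) \<Rightarrow> 'i \<Rightarrow> complex"
    and n m :: nat and c :: real
  assumes c_nonneg: "0 \<le> c"
    and bounded: "\<And>x. (\<And>j. j < m \<Longrightarrow> x j \<in> l2 I) \<Longrightarrow>
        hn_norm I n (opmat_apply m T x) \<le> c * hn_norm I m x"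
begin

lemma hn_norm_apply_le_if_unit:
  assumes "\<And>j. j < m \<Longrightarrow> x j \<in> l2 I" "hn_norm I m x \<le> 1"
  shows "hn_norm I n (opmat_apply m T x) \<le> c"
  using bounded[of x, OF assms(1)] mult_left_mono[OF assms(2) c_nonneg] by simp

lemma opmat_norm_le: "opmat_norm I n m T \<le> c"
  unfolding opmat_norm_def
proof (rule cSup_least)
  show "{hn_norm I n (opmat_apply m T x) |x. (\<forall>j<m. x j \<in> l2 I) \<and> hn_norm I m x \<le> 1} \<noteq> {}"
    using zero_l2 hn_norm_zero[of I m] by (auto intro!: exI[of _ "\<lambda>j t. 0"])
qed (auto intro: hn_norm_apply_le_if_unit)

lemma hn_norm_apply_le_opmat_norm_if_unit:
  assumes "\<And>j. j < m \<Longrightarrow> x j \<in> l2 I" "hn_norm I m x \<le> 1"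
  shows "hn_norm I n (opmat_apply m T x) \<le> opmat_norm I n m T"
  unfolding opmat_norm_def
proof (rule cSup_upper)
  show "bdd_above {hn_norm I n (opmat_apply m T x) |x. (\<forall>j<m. x j \<in> l2 I) \<and> hn_norm I m x \<le> 1}"
    by (rule bdd_aboveI[of _ c]) (auto intro: hn_norm_apply_le_if_unit)
qed (use assms in auto)

lemma opmat_norm_nonneg: "0 \<le> opmat_norm I n m T"
  by (rule order_trans[OF hn_norm_nonneg hn_norm_apply_le_opmat_norm_if_unit[of "\<lambda>j t. 0"]])
     (simp_all add: zero_l2 hn_norm_zero)

lemma hn_norm_apply_le_opmat_norm:
  assumes homogeneous: "\<And>i j a x. T i j (\<lambda>t. a * x t) = (\<lambda>t. a * T i j x t)"
    and x: "\<And>j. j < m \<Longrightarrow> x j \<in> l2 I"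
  shows "hn_norm I n (opmat_apply m T x) \<le> opmat_norm I n m T * hn_norm I m x"
proof (cases "hn_norm I m x = 0")
  case True
  then show ?thesis using bounded[of x, OF x] by simp
next
  case False
  define l where "l = hn_norm I m x"
  have l: "0 < l" using False hn_norm_nonneg[of I m x] unfolding l_def by linarith
  define y where "y j = (\<lambda>t. of_real (1 / l) * x j t)" for j
  have "hn_norm I m y = 1"
    unfolding y_def hn_norm_scale using l by (simp add: norm_divide l_def)
  then have "hn_norm I n (opmat_apply m T y) \<le> opmat_norm I n m T"
    by (intro hn_norm_apply_le_opmat_norm_if_unit) (simp_all only: y_def l2_scale x)
  moreover have "opmat_apply m T y = (\<lambda>i t. of_real (1 / l) * opmat_apply m T x i t)"
    unfolding opmat_apply_def y_def homogeneous sum_distrib_left ..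
  then have "hn_norm I n (opmat_apply m T y) = hn_norm I n (opmat_apply m T x) / l"
    using l by (simp only: hn_norm_scale) (simp add: norm_divide)
  ultimately show ?thesis
    using l unfolding l_def[symmetric] by (simp add: field_simps)
qed

end

section \<open>Block diagonal operators\<close>

definition block_index :: "('k \<times> nat) set \<Rightarrow> ('k \<times> nat \<times> nat) set" where
  "block_index K = {(k, d, r). (k, d) \<in> K \<and> r < d}"

lemma bij_betw_block_index:
  "bij_betw (\<lambda>(b, r). (fst b, snd b, r)) (SIGMA b:K. {..<snd b}) (block_index K)"
  by (rule bij_betw_byWitness[of _ "\<lambda>(k, d, r). ((k, d), r)"]) (auto simp: block_index_def)

lemma
  fixes h :: "'k \<times> nat \<times> nat \<Rightarrow> 'b::banach"
  assumes "h summable_on block_index K"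
  shows summable_on_blocks: "(\<lambda>(k, d). \<Sum>r<d. h (k, d, r)) summable_on K"
    and infsum_block_index: "infsum h (block_index K) = infsum (\<lambda>(k, d). \<Sum>r<d. h (k, d, r)) K"
proof -
  define g where "g = (\<lambda>b r. h (fst b, snd b, r))"
  have g: "(\<lambda>(b, r). g b r) summable_on (SIGMA b:K. {..<snd b})"
    using summable_on_reindex_bij_betw[OF bij_betw_block_index, of h] assms
    by (simp add: g_def split_def)
  then show "(\<lambda>(k, d). \<Sum>r<d. h (k, d, r)) summable_on K"
    using summable_on_Sigma_banach[OF g] by (simp add: g_def split_def)
  have "infsum h (block_index K) = infsum (\<lambda>(b, r). g b r) (SIGMA b:K. {..<snd b})"
    using infsum_reindex_bij_betw[OF bij_betw_block_index, of h] by (simp add: g_def split_def)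
  also have "\<dots> = infsum (\<lambda>b. infsum (g b) {..<snd b}) K"
    by (rule infsum_Sigma'_banach[OF g, symmetric])
  finally show "infsum h (block_index K) = infsum (\<lambda>(k, d). \<Sum>r<d. h (k, d, r)) K"
    by (simp add: g_def split_def)
qed

lemma summable_on_block_index:
  fixes h :: "'k \<times> nat \<times> nat \<Rightarrow> real"
  assumes "\<And>t. 0 \<le> h t" "(\<lambda>(k, d). \<Sum>r<d. h (k, d, r)) summable_on K"
  shows "h summable_on block_index K"
proof -
  have "(\<lambda>(b, r). h (fst b, snd b, r)) summable_on (SIGMA b:K. {..<snd b})"
    by (rule summable_on_SigmaI[OF _ assms(2)]) (auto simp: assms(1) split_def)
  then show ?thesis
    using summable_on_reindex_bij_betw[OF bij_betw_block_index, of h] by (simp add: split_def)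
qed

definition block_part ::
  "'k \<Rightarrow> nat \<Rightarrow> (nat \<Rightarrow> 'k \<times> nat \<times> nat \<Rightarrow> complex) \<Rightarrow> nat \<Rightarrow> nat \<Rightarrow> complex" where
  "block_part k d x = (\<lambda>i r. x i (k, d, r))"

lemma
  assumes x: "\<And>i. i < n \<Longrightarrow> x i \<in> l2 (block_index K)" and y: "\<And>i. i < n \<Longrightarrow> y i \<in> l2 (block_index K)"
  shows hn_inner_blocks_summable:
      "(\<lambda>(k, d). hn_inner {..<d} n (block_part k d x) (block_part k d y)) summable_on K"
    and hn_inner_block_index: "hn_inner (block_index K) n x y
      = infsum (\<lambda>(k, d). hn_inner {..<d} n (block_part k d x) (block_part k d y)) K"
proof -
  define h where "h t = (\<Sum>i<n. x i t * cnj (y i t))" for t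
  have h: "h summable_on block_index K"
    unfolding h_def[abs_def] by (rule hn_inner_summable) (rule x y, assumption)+
  have blocks: "(\<Sum>r<d. h (k, d, r))
      = hn_inner {..<d} n (block_part k d x) (block_part k d y)" for k d
    unfolding h_def hn_inner_lessThan block_part_def by (rule sum.swap)
  show "(\<lambda>(k, d). hn_inner {..<d} n (block_part k d x) (block_part k d y)) summable_on K"
    using summable_on_blocks[OF h] unfolding blocks .
  have "hn_inner (block_index K) n x y = infsum h (block_index K)"
    unfolding h_def[abs_def] by (rule hn_inner_eq_infsum) (rule x y, assumption)+
  then show "hn_inner (block_index K) n x y
      = infsum (\<lambda>(k, d). hn_inner {..<d} n (block_part k d x) (block_part k d y)) K"
    unfolding infsum_block_index[OF h] blocks .
qed

lemma
  assumes x: "\<And>i. i < n \<Longrightarrow> x i \<in> l2 (block_index K)"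
  shows hn_norm_blocks_summable: "(\<lambda>(k, d). (hn_norm {..<d} n (block_part k d x))\<^sup>2) summable_on K"
    and hn_norm_sq_block_index: "(hn_norm (block_index K) n x)\<^sup>2
      = infsum (\<lambda>(k, d). (hn_norm {..<d} n (block_part k d x))\<^sup>2) K"
proof -
  define h where "h t = (\<Sum>i<n. (cmod (x i t))\<^sup>2)" for t
  have h: "h summable_on block_index K"
    unfolding h_def[abs_def] by (rule hn_norm_summable) (rule x)
  have blocks: "(\<Sum>r<d. h (k, d, r)) = (hn_norm {..<d} n (block_part k d x))\<^sup>2" for k d
    unfolding h_def hn_norm_lessThan_sq block_part_def by (rule sum.swap)
  show "(\<lambda>(k, d). (hn_norm {..<d} n (block_part k d x))\<^sup>2) summable_on K"
    using summable_on_blocks[OF h] unfolding blocks .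
  have "(hn_norm (block_index K) n x)\<^sup>2 = infsum h (block_index K)"
    unfolding h_def[abs_def] by (rule hn_norm_sq_eq_infsum) (rule x)
  then show "(hn_norm (block_index K) n x)\<^sup>2
      = infsum (\<lambda>(k, d). (hn_norm {..<d} n (block_part k d x))\<^sup>2) K"
    unfolding infsum_block_index[OF h] blocks .
qed

lemma l2_block_indexI:
  assumes summable: "(\<lambda>(k, d). (hn_norm {..<d} n (block_part k d x))\<^sup>2) summable_on K"
    and support: "\<And>t. t \<notin> block_index K \<Longrightarrow> x i t = 0" and "i < n"
  shows "x i \<in> l2 (block_index K)"
proof -
  define h where "h t = (\<Sum>i<n. (cmod (x i t))\<^sup>2)" for t
  have "(\<Sum>r<d. h (k, d, r)) = (hn_norm {..<d} n (block_part k d x))\<^sup>2" for k d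
    unfolding h_def hn_norm_lessThan_sq block_part_def by (rule sum.swap)
  then have "h summable_on block_index K"
    using summable by (intro summable_on_block_index) (simp_all add: h_def sum_nonneg)
  moreover have "(cmod (x i t))\<^sup>2 \<le> h t" for t
    unfolding h_def by (rule member_le_sum) (use \<open>i < n\<close> in auto)
  ultimately have "(\<lambda>t. (cmod (x i t))\<^sup>2) summable_on block_index K"
    by (rule summable_on_comparison_test) auto
  then show ?thesis using support unfolding l2_def by blast
qed

definition block_diag ::
  "('k \<times> nat) set \<Rightarrow> ('k \<Rightarrow> nat \<Rightarrow> nat \<Rightarrow> complex) \<Rightarrow>
    ('k \<times> nat \<times> nat \<Rightarrow> complex) \<Rightarrow> 'k \<times> nat \<times> nat \<Rightarrow> complex"
  where "block_diag K M x =
    (\<lambda>(k, d, r). if (k, d) \<in> K \<and> r < d then cmat_apply d (M k) (\<lambda>s. x (k, d, s)) r else 0)"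

lemma block_diag_scale: "block_diag K M (\<lambda>t. a * x t) = (\<lambda>t. a * block_diag K M x t)"
  by (auto simp: block_diag_def cmat_apply_def fun_eq_iff sum_distrib_left ac_simps)

lemma block_diag_add:
  "block_diag K M (\<lambda>t. x t + y t) = (\<lambda>t. block_diag K M x t + block_diag K M y t)"
  by (auto simp: block_diag_def cmat_apply_def fun_eq_iff distrib_left sum.distrib)

lemma opmat_apply_block_diag:
  "opmat_apply m (\<lambda>i j. block_diag K (M i j)) x i (k, d, r) =
    (if (k, d) \<in> K \<and> r < d then opmat_apply m (\<lambda>i j. cmat_apply d (M i j k)) (block_part k d x) i r else 0)"
  by (auto simp: opmat_apply_def block_diag_def block_part_def)

lemma block_part_block_diag:
  assumes "(k, d) \<in> K" "r < d"
  shows "block_part k d (opmat_apply m (\<lambda>i j. block_diag K (M i j)) x) i r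
    = opmat_apply m (\<lambda>i j. cmat_apply d (M i j k)) (block_part k d x) i r"
  using assms by (simp add: block_part_def[of k d "opmat_apply m _ x"] opmat_apply_block_diag)

definition block_embed :: "'k \<Rightarrow> nat \<Rightarrow> (nat \<Rightarrow> complex) \<Rightarrow> 'k \<times> nat \<times> nat \<Rightarrow> complex" where
  "block_embed k d v = (\<lambda>(k', d', r). if k' = k \<and> d' = d \<and> r < d then v r else 0)"

lemma block_embed_apply:
  "block_embed k d v (k', d', r) = (if k' = k \<and> d' = d \<and> r < d then v r else 0)"
  by (simp add: block_embed_def)

lemma has_sum_supported_on_block:
  fixes h :: "'k \<times> nat \<times> nat \<Rightarrow> 'b::{topological_comm_monoid_add,t2_space}"
  assumes "(k, d) \<in> K" and supported: "\<And>k' d' r. \<not> (k' = k \<and> d' = d \<and> r < d) \<Longrightarrow> h (k', d', r) = 0"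
  shows "(h has_sum (\<Sum>r<d. h (k, d, r))) (block_index K)"
proof (rule has_sum_finite_neutralI)
  let ?S = "(\<lambda>r. (k, d, r)) ` {..<d}"
  show "finite ?S" "?S \<subseteq> block_index K" using assms(1) by (auto simp: block_index_def)
  show "h t = 0" if "t \<in> block_index K - ?S" for t
    using that supported by (cases t) auto
  show "(\<Sum>r<d. h (k, d, r)) = sum h ?S" by (simp add: sum.reindex inj_on_def)
qed

lemma
  assumes "(k, d) \<in> K"
  shows block_embed_l2: "block_embed k d v \<in> l2 (block_index K)"
    and l2inner_block_embed: "l2inner (block_index K) (block_embed k d v) (block_embed k d w)
        = l2inner {..<d} v w"
    and l2norm_block_embed: "l2norm (block_index K) (block_embed k d v) = l2norm {..<d} v"
proof -
  have "((\<lambda>t. (cmod (block_embed k d v t))\<^sup>2)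
      has_sum (\<Sum>r<d. (cmod (block_embed k d v (k, d, r)))\<^sup>2)) (block_index K)"
    by (rule has_sum_supported_on_block[OF assms]) (auto simp: block_embed_apply)
  then have sq: "((\<lambda>t. (cmod (block_embed k d v t))\<^sup>2)
      has_sum (\<Sum>r<d. (cmod (v r))\<^sup>2)) (block_index K)"
    by (simp add: block_embed_apply)
  then show "block_embed k d v \<in> l2 (block_index K)"
    using assms has_sum_imp_summable unfolding l2_def
    by (auto simp: block_embed_apply block_index_def)
  show "l2norm (block_index K) (block_embed k d v) = l2norm {..<d} v"
    using infsumI[OF sq] by (simp add: l2norm_def)
  have "((\<lambda>t. block_embed k d v t * cnj (block_embed k d w t)) has_sum
      (\<Sum>r<d. block_embed k d v (k, d, r) * cnj (block_embed k d w (k, d, r)))) (block_index K)"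
    by (rule has_sum_supported_on_block[OF assms]) (auto simp: block_embed_apply)
  then show "l2inner (block_index K) (block_embed k d v) (block_embed k d w) = l2inner {..<d} v w"
    by (simp add: l2inner_def infsumI block_embed_apply)
qed

lemma block_diag_block_embed:
  assumes "(k, d) \<in> K"
  shows "opmat_apply m (\<lambda>i j. block_diag K (M i j)) (\<lambda>j. block_embed k d (\<xi> j)) =
    (\<lambda>i. block_embed k d (opmat_apply m (\<lambda>i j. cmat_apply d (M i j k)) \<xi> i))"
proof (intro ext)
  fix i and t :: "'a \<times> nat \<times> nat"
  obtain k' d' r where t: "t = (k', d', r)" by (cases t)
  show "opmat_apply m (\<lambda>i j. block_diag K (M i j)) (\<lambda>j. block_embed k d (\<xi> j)) i t =
      block_embed k d (opmat_apply m (\<lambda>i j. cmat_apply d (M i j k)) \<xi> i) t"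
    using assms unfolding t opmat_apply_block_diag
    by (auto simp: block_embed_apply block_part_def opmat_apply_def cmat_apply_def)
qed

lemma hn_inner_part_block_diag:
  assumes "(k, d) \<in> K"
  shows "hn_inner {..<d} n (block_part k d (opmat_apply m (\<lambda>i j. block_diag K (M i j)) x)) \<xi>
    = hn_inner {..<d} n (opmat_apply m (\<lambda>i j. cmat_apply d (M i j k)) (block_part k d x)) \<xi>"
  using assms by (simp add: hn_inner_lessThan block_part_block_diag)

lemma block_nonneg_if_opmat_pos:
  assumes pos: "opmat_pos (block_index K) n (\<lambda>i j. block_diag K (M i j))" and block: "(k, d) \<in> K"
  shows "0 \<le> hn_inner {..<d} n (opmat_apply n (\<lambda>i j. cmat_apply d (M i j k)) \<xi>) \<xi>"
proof -
  let ?x = "\<lambda>j. block_embed k d (\<xi> j)"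
  have "0 \<le> hn_inner (block_index K) n (opmat_apply n (\<lambda>i j. block_diag K (M i j)) ?x) ?x"
    by (rule pos[unfolded opmat_pos_iff, rule_format]) (rule block_embed_l2[OF block])
  then show ?thesis
    unfolding block_diag_block_embed[OF block]
    by (simp add: hn_inner_def l2inner_block_embed[OF block])
qed

context
  fixes K :: "('k \<times> nat) set" and M :: "nat \<Rightarrow> nat \<Rightarrow> 'k \<Rightarrow> nat \<Rightarrow> nat \<Rightarrow> complex"
    and n m :: nat and C :: real
  assumes C_nonneg: "0 \<le> C"
    and blocks_bounded: "\<And>k d \<xi>. (k, d) \<in> K \<Longrightarrow>
      hn_norm {..<d} n (opmat_apply m (\<lambda>i j. cmat_apply d (M i j k)) \<xi>) \<le> C * hn_norm {..<d} m \<xi>"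
begin

lemma
  assumes x: "\<And>j. j < m \<Longrightarrow> x j \<in> l2 (block_index K)"
  defines "y \<equiv> opmat_apply m (\<lambda>i j. block_diag K (M i j)) x"
  shows block_diag_l2: "i < n \<Longrightarrow> y i \<in> l2 (block_index K)"
    and hn_norm_block_diag_le: "hn_norm (block_index K) n y \<le> C * hn_norm (block_index K) m x"
proof -
  define U where "U = (\<lambda>(k, d). (hn_norm {..<d} m (block_part k d x))\<^sup>2)"
  define W where "W = (\<lambda>(k, d). (hn_norm {..<d} n (block_part k d y))\<^sup>2)"
  have W_le: "W b \<le> C\<^sup>2 * U b" if "b \<in> K" for b
  proof -
    obtain k d where b: "b = (k, d)" by (cases b)
    have "W b = (hn_norm {..<d} n (opmat_apply m (\<lambda>i j. cmat_apply d (M i j k)) (block_part k d x)))\<^sup>2"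
      using that unfolding W_def b y_def hn_norm_lessThan_sq by (simp add: block_part_block_diag)
    also have "\<dots> \<le> (C * hn_norm {..<d} m (block_part k d x))\<^sup>2"
      using blocks_bounded[of k d] that unfolding b by (intro power_mono) auto
    finally show ?thesis by (simp add: U_def b power_mult_distrib)
  qed
  have U: "(\<lambda>b. C\<^sup>2 * U b) summable_on K"
    unfolding U_def by (intro summable_on_cmult_right hn_norm_blocks_summable x)
  then have W: "W summable_on K"
    by (rule summable_on_comparison_test[OF _ W_le]) (simp_all add: W_def split_def)
  have y: "y i \<in> l2 (block_index K)" if "i < n" for i
    by (rule l2_block_indexI[OF W[unfolded W_def] _ that])
       (auto simp: y_def block_index_def opmat_apply_block_diag split: if_splits)
  then show "i < n \<Longrightarrow> y i \<in> l2 (block_index K)" .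
  have "(hn_norm (block_index K) n y)\<^sup>2 = infsum W K"
    unfolding W_def by (rule hn_norm_sq_block_index) (rule y)
  also have "\<dots> \<le> infsum (\<lambda>b. C\<^sup>2 * U b) K"
    by (rule infsum_mono[OF W U W_le])
  also have "\<dots> = C\<^sup>2 * infsum U K"
    by (rule infsum_cmult_right')
  also have "infsum U K = (hn_norm (block_index K) m x)\<^sup>2"
    unfolding U_def by (rule hn_norm_sq_block_index[symmetric]) (rule x)
  finally show "hn_norm (block_index K) n y \<le> C * hn_norm (block_index K) m x"
    unfolding power_mult_distrib[symmetric] by (rule power2_le_imp_le) (simp add: C_nonneg)
qed

lemma opmat_norm_block_diag_le: "opmat_norm (block_index K) n m (\<lambda>i j. block_diag K (M i j)) \<le> C"
  by (rule opmat_norm_le[OF C_nonneg]) (rule hn_norm_block_diag_le)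

lemma block_le_opmat_norm:
  assumes "(k, d) \<in> K"
  shows "hn_norm {..<d} n (opmat_apply m (\<lambda>i j. cmat_apply d (M i j k)) \<xi>)
    \<le> opmat_norm (block_index K) n m (\<lambda>i j. block_diag K (M i j)) * hn_norm {..<d} m \<xi>"
proof -
  have norm: "hn_norm (block_index K) l (\<lambda>j. block_embed k d (\<eta> j)) = hn_norm {..<d} l \<eta>" for l \<eta>
    by (simp add: hn_norm_def l2norm_block_embed[OF assms])
  have "hn_norm (block_index K) n (opmat_apply m (\<lambda>i j. block_diag K (M i j)) (\<lambda>j. block_embed k d (\<xi> j)))
      \<le> opmat_norm (block_index K) n m (\<lambda>i j. block_diag K (M i j))
        * hn_norm (block_index K) m (\<lambda>j. block_embed k d (\<xi> j))"
    by (rule hn_norm_apply_le_opmat_norm[OF C_nonneg hn_norm_block_diag_le])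
       (simp_all add: block_diag_scale block_embed_l2[OF assms])
  then show ?thesis unfolding block_diag_block_embed[OF assms] norm .
qed

end

lemma opmat_pos_block_diag_iff:
  fixes M :: "nat \<Rightarrow> nat \<Rightarrow> 'k \<Rightarrow> nat \<Rightarrow> nat \<Rightarrow> complex"
  assumes "0 \<le> C"
    and blocks_bounded: "\<And>k d \<xi>. (k, d) \<in> K \<Longrightarrow>
      hn_norm {..<d} n (opmat_apply n (\<lambda>i j. cmat_apply d (M i j k)) \<xi>) \<le> C * hn_norm {..<d} n \<xi>"
  shows "opmat_pos (block_index K) n (\<lambda>i j. block_diag K (M i j)) \<longleftrightarrow>
    (\<forall>(k, d)\<in>K. \<forall>\<xi>. 0 \<le> hn_inner {..<d} n (opmat_apply n (\<lambda>i j. cmat_apply d (M i j k)) \<xi>) \<xi>)"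
    (is "opmat_pos _ _ ?T \<longleftrightarrow> ?R")
proof
  assume pos: "opmat_pos (block_index K) n ?T"
  show ?R
    using block_nonneg_if_opmat_pos[OF pos] by blast
next
  assume blocks_nonneg: ?R
  show "opmat_pos (block_index K) n ?T"
    unfolding opmat_pos_iff
  proof (intro allI impI)
    fix x :: "nat \<Rightarrow> 'k \<times> nat \<times> nat \<Rightarrow> complex"
    assume "\<forall>j<n. x j \<in> l2 (block_index K)"
    then have x: "\<And>j. j < n \<Longrightarrow> x j \<in> l2 (block_index K)" by blast
    define y where "y = opmat_apply n ?T x"
    have y: "y i \<in> l2 (block_index K)" if "i < n" for i
      unfolding y_def using that by (intro block_diag_l2[OF assms(1) blocks_bounded x])
    have "0 \<le> hn_inner {..<d} n (block_part k d y) (block_part k d x)" if "(k, d) \<in> K" for k d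
      using blocks_nonneg that unfolding y_def hn_inner_part_block_diag[OF that] by blast
    then have "0 \<le> infsum (\<lambda>(k, d). hn_inner {..<d} n (block_part k d y) (block_part k d x)) K"
      by (intro infsum_nonneg_complex hn_inner_blocks_summable x y) auto
    also have "\<dots> = hn_inner (block_index K) n y x"
      by (rule hn_inner_block_index[symmetric]) (rule x y, assumption)+
    finally show "0 \<le> hn_inner (block_index K) n (opmat_apply n ?T x) x"
      unfolding y_def .
  qed
qed

section \<open>Matrices over a star vector space\<close>

definition vec_scale :: "complex \<Rightarrow> (nat \<Rightarrow> complex) \<Rightarrow> nat \<Rightarrow> complex" where
  "vec_scale c v = (\<lambda>i. c * v i)"

lemma vector_space_vec_scale: "vector_space vec_scale"
  by unfold_locales (auto simp: vec_scale_def fun_eq_iff algebra_simps)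

lemma vector_space_mscale:
  assumes "vector_space sc"
  shows "vector_space (mscale sc)"
proof -
  interpret vector_space sc by fact
  show ?thesis
    by unfold_locales (auto simp: mscale_def fun_eq_iff scale_right_distrib scale_left_distrib)
qed

interpretation matrix_form: Vector_Spaces.linear "mscale (*)" "(*)"
    "\<lambda>h. matrix_form n h a b" for n a b
  unfolding Vector_Spaces.linear_iff
proof (intro conjI allI)
  show "matrix_form n (h + h') a b = matrix_form n h a b + matrix_form n h' a b" for h h'
    by (simp add: matrix_form_def cmat_apply_def algebra_simps sum.distrib)
  show "matrix_form n (mscale (*) c h) a b = c * matrix_form n h a b" for c h
    by (simp add: matrix_form_def cmat_apply_def mscale_def sum_distrib_left ac_simps)
qed (intro vector_space_mscale vector_space_over_itself.vector_space_axioms)+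

lemma matrix_form_cstar: "matrix_form n (cstar h) a b = cnj (matrix_form n h b a)"
  using cmat_apply_cstar_adjoint[where w = a and X = h and v = b]
  by (simp add: matrix_form_def mult.commute)

definition amplification ::
  "('v \<Rightarrow> 'a \<Rightarrow> 'b \<Rightarrow> complex) \<Rightarrow> nat \<Rightarrow> nat \<Rightarrow> (nat \<Rightarrow> nat \<Rightarrow> 'v) \<Rightarrow> (nat \<Rightarrow> 'a) \<Rightarrow> (nat \<Rightarrow> 'b) \<Rightarrow> complex"
  where "amplification S n m A a b = (\<Sum>i<n. \<Sum>j<m. S (A i j) (a i) (b j))"

lemma dsum_mats:
  assumes "A \<in> mats n m" "B \<in> mats p q"
  shows "dsum n m A B \<in> mats (n + p) (m + q)"
proof -
  have "i < n + p \<and> j < m + q" if "n \<le> i" "m \<le> j" "B (i - n) (j - m) \<noteq> 0" for i j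
    using assms(2) that unfolding mats_def by fastforce
  then show ?thesis using assms(1) unfolding mats_def dsum_def by auto
qed

locale star_space =
  fixes sc :: "complex \<Rightarrow> 'v::ab_group_add \<Rightarrow> 'v" and st :: "'v \<Rightarrow> 'v"
  assumes star_vector_space: "star_vector_space sc st"
begin

sublocale vector_space sc
  using star_vector_space unfolding star_vector_space_def by blast

lemma st_st [simp]: "st (st x) = x"
  using star_vector_space unfolding star_vector_space_def by blast

lemma st_scale_add: "st (sc c x + y) = sc (cnj c) (st x) + st y"
  using star_vector_space unfolding star_vector_space_def by blast

lemma st_add: "st (x + y) = st x + st y"
  using st_scale_add[of 1 x y] by simp

lemma st_zero [simp]: "st 0 = 0"
  using st_add[of 0 0] by simp

lemma st_eq_0_iff [simp]: "st x = 0 \<longleftrightarrow> x = 0"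
  by (metis st_st st_zero)

lemma st_scale: "st (sc c x) = sc (cnj c) (st x)"
  using st_scale_add[of c x 0] by simp

lemma st_uminus: "st (- x) = - st x"
  using st_scale[of "- 1" x] by simp

lemma st_diff: "st (x - y) = st x - st y"
  using st_add[of "x - y" y] by simp

lemma st_sum: "st (\<Sum>i\<in>I. f i) = (\<Sum>i\<in>I. st (f i))"
  by (induction I rule: infinite_finite_induct) (simp_all add: st_add)

lemma star_space_matrices: "star_space (mscale sc) (mstar st)"
  unfolding star_space_def star_vector_space_def
  by (auto simp: vector_space_mscale vector_space_axioms fun_eq_iff mscale_def mstar_def st_scale_add)

text \<open>Applying the hypothesis to \<open>x\<close>, \<open>st x\<close> and \<open>\<i> x\<close> shows that the real and imaginary parts agree.\<close>
lemma linear_functional_star_eq_cnj: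
  assumes "Vector_Spaces.linear sc (*) F" and nonpos: "\<And>x. Re (F (x - st x)) \<le> 0"
  shows "F (st x) = cnj (F x)"
proof -
  interpret F: Vector_Spaces.linear sc "(*)" F by fact
  have Re_st: "Re (F (st x)) = Re (F x)" for x
    using nonpos[of x] nonpos[of "st x"] by (simp add: F.diff)
  have "Im (F (st x)) = - Im (F x)"
    using Re_st[of "sc \<i> x"] by (simp add: st_scale F.scale F.neg)
  then show ?thesis using Re_st by (simp add: complex_eq_iff)
qed

definition rank_one :: "nat \<Rightarrow> 'v \<Rightarrow> (nat \<Rightarrow> complex) \<Rightarrow> (nat \<Rightarrow> complex) \<Rightarrow> nat \<Rightarrow> nat \<Rightarrow> 'v" where
  "rank_one n v a b = (\<lambda>i j. if i < n \<and> j < n then sc (cnj (a i) * b j) v else 0)"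

lemma rank_one_add_vec: "rank_one n (v + w) a b = rank_one n v a b + rank_one n w a b"
  by (auto simp: rank_one_def fun_eq_iff scale_right_distrib)

lemma rank_one_scale_vec: "rank_one n (sc c v) a b = mscale sc c (rank_one n v a b)"
  by (auto simp: rank_one_def mscale_def fun_eq_iff ac_simps)

lemma mstar_rank_one: "mstar st (rank_one n v a b) = rank_one n (st v) b a"
  by (auto simp: rank_one_def mstar_def fun_eq_iff st_scale ac_simps)

lemma sesquilinear_form_rank_one:
  assumes "Vector_Spaces.linear (mscale sc) (*) F"
  shows "sesquilinear_form vec_scale (\<lambda>a b. F (rank_one n v a b))"
proof -
  interpret F: Vector_Spaces.linear "mscale sc" "(*)" F by fact
  interpret vec: vector_space vec_scale by (rule vector_space_vec_scale)
  show ?thesis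
  proof unfold_locales
    show "F (rank_one n v (a + a') b) = F (rank_one n v a b) + F (rank_one n v a' b)" for a a' b
      unfolding F.add[symmetric]
      by (rule arg_cong[of _ _ F])
          (auto simp: rank_one_def fun_eq_iff distrib_right scale_left_distrib)
    show "F (rank_one n v a (b + b')) = F (rank_one n v a b) + F (rank_one n v a b')" for a b b'
      unfolding F.add[symmetric]
      by (rule arg_cong[of _ _ F])
          (auto simp: rank_one_def fun_eq_iff distrib_left scale_left_distrib)
    show "F (rank_one n v (vec_scale c a) b) = cnj c * F (rank_one n v a b)" for c a b
      unfolding F.scale[symmetric]
      by (rule arg_cong[of _ _ F])
          (auto simp: rank_one_def mscale_def vec_scale_def fun_eq_iff ac_simps)
    show "F (rank_one n v a (vec_scale c b)) = c * F (rank_one n v a b)" for c a b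
      unfolding F.scale[symmetric]
      by (rule arg_cong[of _ _ F])
          (auto simp: rank_one_def mscale_def vec_scale_def fun_eq_iff ac_simps)
  qed
qed

definition congruence :: "nat \<Rightarrow> nat \<Rightarrow> (nat \<Rightarrow> nat \<Rightarrow> complex) \<Rightarrow> (nat \<Rightarrow> nat \<Rightarrow> 'v) \<Rightarrow> nat \<Rightarrow> nat
    \<Rightarrow> 'v" where
  "congruence n k X x = smul3 sc n k k n (cstar X) x X"

lemma congruence_apply: "congruence n k X x i j =
    (if i < n \<and> j < n then \<Sum>p<k. \<Sum>q<k. sc (cnj (X p i) * X q j) (x p q) else 0)"
  unfolding congruence_def smul3_def cstar_def by simp

lemma congruence_eq_sum_rank_one:
  "congruence n k X x = (\<Sum>p<k. \<Sum>q<k. rank_one n (x p q) (X p) (X q))"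
  by (auto simp: fun_eq_iff sum_fun_apply congruence_apply rank_one_def)

lemma congruence_mscale: "congruence n k X (mscale sc c x) = mscale sc c (congruence n k X x)"
  by (auto simp: fun_eq_iff congruence_apply mscale_def scale_sum_right mult.commute)

lemma congruence_stack_dsum:
  "congruence n (k + l) (\<lambda>p. if p < k then X p else Y (p - k)) (dsum k k x y)
    = congruence n k X x + congruence n l Y y"
  by (auto simp: fun_eq_iff congruence_apply sum_lessThan_add dsum_def)

lemma sa_mats_iff:
  "A \<in> sa_mats st n \<longleftrightarrow> (\<forall>i j. (i < n \<and> j < n \<or> A i j = 0) \<and> st (A j i) = A i j)"
  unfolding sa_mats_def mats_def mstar_def by (auto simp: fun_eq_iff)

lemma sa_mats_mats: "A \<in> sa_mats st n \<Longrightarrow> A \<in> mats n n"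
  unfolding sa_mats_def by blast

lemma sa_mats_zero: "0 \<in> sa_mats st n"
  unfolding sa_mats_iff by simp

lemma sa_mats_uminus: "A \<in> sa_mats st n \<Longrightarrow> - A \<in> sa_mats st n"
  unfolding sa_mats_iff by (auto simp: st_uminus)

lemma sa_mats_mscale_real: "A \<in> sa_mats st n \<Longrightarrow> mscale sc (of_real c) A \<in> sa_mats st n"
  unfolding sa_mats_iff mscale_def by (auto simp: st_scale)

lemma sa_mats_dsum:
  assumes "A \<in> sa_mats st n" "B \<in> sa_mats st k"
  shows "dsum n n A B \<in> sa_mats st (n + k)"
proof -
  have "mstar st (dsum n n A B) = dsum n n A B"
    using assms unfolding sa_mats_iff mstar_def dsum_def by (auto simp: fun_eq_iff)
  then show ?thesis
    using dsum_mats assms unfolding sa_mats_def by blast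
qed

lemma sa_mats_congruence: "x \<in> sa_mats st k \<Longrightarrow> congruence n k X x \<in> sa_mats st n"
  unfolding sa_mats_iff congruence_apply
  by (auto simp: st_sum st_scale mult.commute intro!: sum.swap[THEN trans] sum.cong)

definition herm_part :: "nat \<Rightarrow> (nat \<Rightarrow> nat \<Rightarrow> 'v) \<Rightarrow> nat \<Rightarrow> nat \<Rightarrow> 'v" where
  "herm_part n y = (\<lambda>i j. if i < n \<and> j < n then sc (1/2) (y i j + st (y j i)) else 0)"

lemma sa_mats_herm_part: "herm_part n y \<in> sa_mats st n"
  unfolding sa_mats_iff herm_part_def by (auto simp: st_scale st_add add.commute)

lemma herm_part_sa:
  assumes "y \<in> sa_mats st n"
  shows "herm_part n y = y"
proof -
  have "sc (1/2) (v + v) = v" for v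
    using scale_left_distrib[of "1/2" "1/2" v] by (simp add: scale_right_distrib)
  then show ?thesis using assms unfolding sa_mats_iff herm_part_def by (auto simp: fun_eq_iff)
qed

lemma herm_part_add: "herm_part n (y + z) = herm_part n y + herm_part n z"
  unfolding herm_part_def by (auto simp: fun_eq_iff st_add scale_right_distrib)

lemma herm_part_mscale_real:
  "herm_part n (mscale sc (of_real c) y) = mscale sc (of_real c) (herm_part n y)"
  unfolding herm_part_def mscale_def
  by (auto simp: fun_eq_iff st_scale scale_right_distrib mult.commute)

lemma herm_part_diff_mstar: "herm_part n (y - mstar st y) = 0"
  unfolding herm_part_def mstar_def by (auto simp: fun_eq_iff st_diff)

definition sa_dilation :: "nat \<Rightarrow> (nat \<Rightarrow> nat \<Rightarrow> 'v) \<Rightarrow> nat \<Rightarrow> nat \<Rightarrow> 'v" where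
  "sa_dilation k x = (\<lambda>i j. if i < k \<and> k \<le> j then x i (j - k)
    else if k \<le> i \<and> j < k then st (x j (i - k)) else 0)"

lemma sa_mats_sa_dilation:
  assumes "x \<in> mats k l"
  shows "sa_dilation k x \<in> sa_mats st (k + l)"
proof -
  have "j < k + l" if "k \<le> j" "x i (j - k) \<noteq> 0" for i j
    using assms that unfolding mats_def by fastforce
  then show ?thesis unfolding sa_mats_iff sa_dilation_def by auto
qed

end

interpretation scalar: star_space "(*)" cnj
  by unfold_locales (auto simp: star_vector_space_def vector_space_over_itself.vector_space_axioms)

lemma cstar_eq_mstar: "cstar = mstar cnj"
  by (simp add: cstar_def mstar_def fun_eq_iff)

lemma matrix_form_rank_one:
  "matrix_form n (scalar.rank_one n 1 a a) w w = of_real ((cmod (\<Sum>i<n. a i * w i))\<^sup>2)"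
proof -
  have "matrix_form n (scalar.rank_one n 1 a a) w w = (\<Sum>i<n. \<Sum>j<n. cnj (a i * w i) * (a j * w j))"
    unfolding matrix_form_def cmat_apply_def scalar.rank_one_def sum_distrib_left
    by (intro sum.cong refl) (simp add: ac_simps)
  also have "\<dots> = cnj (\<Sum>i<n. a i * w i) * (\<Sum>j<n. a j * w j)"
    by (simp add: sum_product)
  finally show ?thesis unfolding complex_norm_square by (simp add: mult.commute)
qed

locale hermitian_form_family = star_space sc st
  for sc :: "complex \<Rightarrow> 'v::ab_group_add \<Rightarrow> 'v" and st +
  fixes S :: "'v \<Rightarrow> 'a \<Rightarrow> 'a \<Rightarrow> complex"
  assumes linear_form: "Vector_Spaces.linear sc (*) (\<lambda>v. S v a b)"
    and form_st: "S (st v) b a = cnj (S v a b)"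
begin

lemma form_zero: "S 0 a b = 0"
  and form_add: "S (v + w) a b = S v a b + S w a b"
  and form_scale: "S (sc c v) a b = c * S v a b"
proof -
  interpret Vector_Spaces.linear sc "(*)" "\<lambda>v. S v a b" by (rule linear_form)
  show "S 0 a b = 0" "S (v + w) a b = S v a b + S w a b" "S (sc c v) a b = c * S v a b"
    by (fact zero add scale)+
qed

lemma amplification_zero: "amplification S n m 0 a b = 0"
  by (simp add: amplification_def form_zero)

lemma amplification_mscale:
  "amplification S n m (mscale sc c A) a b = c * amplification S n m A a b"
  by (simp add: amplification_def mscale_def form_scale sum_distrib_left)

lemma amplification_uminus: "amplification S n m (- A) a b = - amplification S n m A a b"
  using form_scale[of "- 1"] by (simp add: amplification_def sum_negf)

lemma amplification_diff:
  "amplification S n m (A - A') a b = amplification S n m A a b - amplification S n m A' a b"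
proof -
  have "S (v - w) a b = S v a b - S w a b" for v w a b
    using form_add[of "v - w" w] by simp
  then show ?thesis by (simp add: amplification_def sum_subtractf)
qed

lemma amplification_mstar: "amplification S m n (mstar st A) b a = cnj (amplification S n m A a b)"
  unfolding amplification_def mstar_def form_st by (subst sum.swap) simp

lemma amplification_sa_dilation:
  "amplification S (n + m) (n + m) (sa_dilation n A) a a
    = of_real (2 * Re (amplification S n m A a (\<lambda>j. a (n + j))))"
proof -
  have "amplification S (n + m) (n + m) (sa_dilation n A) a a
      = amplification S n m A a (\<lambda>j. a (n + j)) + amplification S m n (mstar st A) (\<lambda>j. a (n + j)) a"
    by (simp add: amplification_def sum_lessThan_add sa_dilation_def mstar_def form_zero)
  then show ?thesis by (simp add: amplification_mstar complex_add_cnj)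
qed

end

section \<open>Norms of submatrices and of compressions\<close>

definition selection :: "(nat \<Rightarrow> nat) \<Rightarrow> nat \<Rightarrow> nat \<Rightarrow> complex" where
  "selection f = (\<lambda>i j. of_bool (j = f i))"

lemma cmat_apply_selection:
  assumes "f i < n"
  shows "cmat_apply n (selection f) v i = v (f i)"
proof -
  have "cmat_apply n (selection f) v i = (\<Sum>j<n. if j = f i then v j else 0)"
    unfolding cmat_apply_def selection_def by (intro sum.cong refl) auto
  then show ?thesis using assms by simp
qed

lemma cstar_selection_id: "cstar (selection id) = selection id"
  by (auto simp: cstar_def selection_def fun_eq_iff)

lemma vnorm_selection_le:
  assumes "inj_on f {..<k}" "f ` {..<k} \<subseteq> {..<n}"
  shows "vnorm k (cmat_apply n (selection f) v) \<le> vnorm n v"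
proof -
  have "(\<Sum>i<k. (cmod (cmat_apply n (selection f) v i))\<^sup>2) = (\<Sum>i<k. (cmod (v (f i)))\<^sup>2)"
    using assms(2) by (intro sum.cong refl) (auto simp: cmat_apply_selection)
  also have "\<dots> = (\<Sum>j\<in>f ` {..<k}. (cmod (v j))\<^sup>2)"
    using assms(1) by (simp add: sum.reindex)
  also have "\<dots> \<le> (\<Sum>j<n. (cmod (v j))\<^sup>2)"
    using assms(2) by (intro sum_mono2) auto
  finally show ?thesis unfolding vnorm_def by simp
qed

context star_space
begin

lemma smul3_selection:
  assumes "f ` {..<k} \<subseteq> {..<n}" "g ` {..<l} \<subseteq> {..<m}"
  shows "smul3 sc k n m l (selection f) A (cstar (selection g))
    = (\<lambda>i j. if i < k \<and> j < l then A (f i) (g j) else 0)"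
proof (intro ext)
  fix i j
  have "(\<Sum>p<n. \<Sum>q<m. sc (selection f i p * cstar (selection g) q j) (A p q)) = A (f i) (g j)"
    if "i < k" "j < l"
  proof -
    have "(\<Sum>p<n. \<Sum>q<m. sc (selection f i p * cstar (selection g) q j) (A p q))
        = (\<Sum>p<n. \<Sum>q<m. if q = g j then (if p = f i then A p q else 0) else 0)"
      by (intro sum.cong refl) (auto simp: selection_def cstar_def)
    moreover have "f i < n" "g j < m" using assms that by auto
    ultimately show ?thesis by simp
  qed
  then show "smul3 sc k n m l (selection f) A (cstar (selection g)) i j
      = (if i < k \<and> j < l then A (f i) (g j) else 0)"
    unfolding smul3_def by simp
qed

lemma congruence_selection_id:
  assumes "A \<in> mats n n"
  shows "congruence n n (selection id) A = A"
proof -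
  have "congruence n n (selection id) A = smul3 sc n n n n (selection id) A (cstar (selection id))"
    unfolding congruence_def cstar_selection_id ..
  also have "\<dots> = A"
    using assms by (subst smul3_selection) (auto simp: mats_def fun_eq_iff)
  finally show ?thesis .
qed

end

locale star_opspace =
  fixes sc :: "complex \<Rightarrow> 'v::ab_group_add \<Rightarrow> 'v" and st :: "'v \<Rightarrow> 'v"
    and nrm :: "nat \<Rightarrow> nat \<Rightarrow> (nat \<Rightarrow> nat \<Rightarrow> 'v) \<Rightarrow> real"
  assumes star_operator_space: "star_operator_space sc st nrm"
begin

sublocale star_space sc st
  using star_operator_space unfolding star_operator_space_def by unfold_locales blast

lemma operator_space: "operator_space sc nrm"
  using star_operator_space unfolding star_operator_space_def by blast

context
  fixes n m :: nat
  assumes nm: "1 \<le> n" "1 \<le> m"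
begin

lemma nrm_nonneg: "A \<in> mats n m \<Longrightarrow> 0 \<le> nrm n m A"
  and nrm_eq_0_iff: "A \<in> mats n m \<Longrightarrow> nrm n m A = 0 \<longleftrightarrow> A = 0"
  and nrm_mscale: "A \<in> mats n m \<Longrightarrow> nrm n m (mscale sc c A) = cmod c * nrm n m A"
  using operator_space nm by (simp_all add: operator_space_def zero_fun_def)

lemma nrm_zero: "nrm n m 0 = 0"
  using nrm_eq_0_iff[of 0] by (simp add: mats_def)

lemma nrm_uminus: "A \<in> mats n m \<Longrightarrow> nrm n m (- A) = nrm n m A"
  using nrm_mscale[of A "- 1"] by (simp add: mscale_def fun_Compl_def)

lemma nrm_mstar: "A \<in> mats n m \<Longrightarrow> nrm m n (mstar st A) = nrm n m A"
  using star_operator_space nm unfolding star_operator_space_def by blast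

lemma nrm_dsum: "1 \<le> p \<Longrightarrow> 1 \<le> q \<Longrightarrow> A \<in> mats n m \<Longrightarrow> B \<in> mats p q \<Longrightarrow>
    nrm (n + p) (m + q) (dsum n m A B) = max (nrm n m A) (nrm p q B)"
  using operator_space nm unfolding operator_space_def by blast

lemma nrm_smul3_le:
  assumes kl: "1 \<le> k" "1 \<le> l" and A: "A \<in> mats n m" and c: "0 \<le> c" "0 \<le> d"
    and X: "\<And>v. vnorm k (cmat_apply n X v) \<le> c * vnorm n v"
    and Y: "\<And>v. vnorm m (cmat_apply l Y v) \<le> d * vnorm l v"
  shows "nrm k l (smul3 sc k n m l X A Y) \<le> c * nrm n m A * d"
proof -
  have "nrm k l (smul3 sc k n m l X A Y) \<le> cmat_norm k n X * nrm n m A * cmat_norm m l Y"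
    using operator_space nm kl A unfolding operator_space_def by blast
  also have "\<dots> \<le> c * nrm n m A * d"
    using cmat_norm_bounds[OF c(1) X] cmat_norm_bounds[OF c(2) Y] nrm_nonneg[OF A] c
    by (intro mult_mono) auto
  finally show ?thesis .
qed

lemma nrm_submatrix_le:
  assumes kl: "1 \<le> k" "1 \<le> l" and A: "A \<in> mats n m"
    and f: "inj_on f {..<k}" "f ` {..<k} \<subseteq> {..<n}" and g: "inj_on g {..<l}" "g ` {..<l} \<subseteq> {..<m}"
  shows "nrm k l (\<lambda>i j. if i < k \<and> j < l then A (f i) (g j) else 0) \<le> nrm n m A"
proof -
  have "vnorm m (cmat_apply l (cstar (selection g)) v) \<le> 1 * vnorm l v" for v
    using vnorm_selection_le[OF g] by (intro vnorm_cstar_apply_le) auto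
  then have "nrm k l (smul3 sc k n m l (selection f) A (cstar (selection g))) \<le> 1 * nrm n m A * 1"
    using vnorm_selection_le[OF f] by (intro nrm_smul3_le kl A) auto
  then show ?thesis by (simp add: smul3_selection[OF f(2) g(2)])
qed

end

lemma nrm_congruence_le:
  assumes "1 \<le> n" "1 \<le> k" "x \<in> mats k k" "0 \<le> c"
    and X: "\<And>w. vnorm k (cmat_apply n X w) \<le> c * vnorm n w"
  shows "nrm n n (congruence n k X x) \<le> c\<^sup>2 * nrm k k x"
  unfolding congruence_def
  using nrm_smul3_le[OF assms(2,2,1,1,3,4,4) vnorm_cstar_apply_le[OF assms(4) X] X]
  by (simp add: power2_eq_square ac_simps)

text \<open>Exchanging the two column blocks turns \<open>sa_dilation k x\<close> into the direct sum of \<open>x\<close> and \<open>x\<^sup>*\<close>.\<close>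
lemma nrm_sa_dilation:
  assumes k: "1 \<le> k" and l: "1 \<le> l" and x: "x \<in> mats k l"
  shows "nrm (k + l) (k + l) (sa_dilation k x) = nrm k l x"
proof (rule antisym)
  have kl: "1 \<le> k + l" "1 \<le> l + k" using k by auto
  have xs: "mstar st x \<in> mats l k" using x unfolding mats_def mstar_def by auto
  define \<tau> where "\<tau> j = (if j < k then l + j else j - k)" for j
  have sa_dilation: "sa_dilation k x \<in> mats (k + l) (k + l)"
    using sa_mats_mats[OF sa_mats_sa_dilation[OF x]] .
  then have "sa_dilation k x i j = 0" if "\<not> (i < k + l \<and> j < k + l)" for i j
    using that unfolding mats_def by blast
  moreover have "sa_dilation k x i j = dsum k l x (mstar st x) i (\<tau> j)"
    if "i < k + l \<and> j < k + l" for i j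
    unfolding sa_dilation_def dsum_def \<tau>_def mstar_def using that by auto
  ultimately have "sa_dilation k x
      = (\<lambda>i j. if i < k + l \<and> j < k + l then dsum k l x (mstar st x) (id i) (\<tau> j) else 0)"
    by (auto simp: fun_eq_iff)
  then have "nrm (k + l) (k + l) (sa_dilation k x) =
      nrm (k + l) (k + l) (\<lambda>i j. if i < k + l \<and> j < k + l then dsum k l x (mstar st x) (id i) (\<tau> j) else 0)"
    by (rule arg_cong)
  also have "\<dots> \<le> nrm (k + l) (l + k) (dsum k l x (mstar st x))"
    by (rule nrm_submatrix_le[OF kl(1,2,1,1) dsum_mats[OF x xs]])
       (auto simp: \<tau>_def inj_on_def split: if_splits)
  also have "\<dots> = nrm k l x"
    using nrm_dsum[OF k l l k x xs] nrm_mstar[OF k l x] by simp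
  finally show "nrm (k + l) (k + l) (sa_dilation k x) \<le> nrm k l x" .
  have "x = (\<lambda>i j. if i < k \<and> j < l then sa_dilation k x (id i) (k + j) else 0)"
    using x unfolding mats_def sa_dilation_def by (auto simp: fun_eq_iff)
  then have "nrm k l x
      = nrm k l (\<lambda>i j. if i < k \<and> j < l then sa_dilation k x (id i) (k + j) else 0)"
    by (rule arg_cong)
  also have "\<dots> \<le> nrm (k + l) (k + l) (sa_dilation k x)"
    by (rule nrm_submatrix_le[OF kl(1,1) k l sa_dilation]) auto
  finally show "nrm k l x \<le> nrm (k + l) (k + l) (sa_dilation k x)" .
qed

end

section \<open>The gauge of a normal matrix ordered operator space\<close>

locale normal_space =
  fixes sc :: "complex \<Rightarrow> 'v::ab_group_add \<Rightarrow> 'v" and st :: "'v \<Rightarrow> 'v"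
    and nrm :: "nat \<Rightarrow> nat \<Rightarrow> (nat \<Rightarrow> nat \<Rightarrow> 'v) \<Rightarrow> real"
    and pos :: "nat \<Rightarrow> (nat \<Rightarrow> nat \<Rightarrow> 'v) set"
  assumes normal: "normal_mo_star_opspace sc st nrm pos"
begin

lemma matrix_ordered: "matrix_ordered sc st nrm pos"
  using normal unfolding normal_mo_star_opspace_def by blast

sublocale star_opspace sc st nrm
  using matrix_ordered unfolding matrix_ordered_def by unfold_locales blast

context
  fixes n :: nat
  assumes n: "1 \<le> n"
begin

lemma pos_sa_mats: "A \<in> pos n \<Longrightarrow> A \<in> sa_mats st n"
  using matrix_ordered n unfolding matrix_ordered_def by blast

lemma pos_cone: "proper_cone sc (pos n)"
  using matrix_ordered n unfolding matrix_ordered_def by blast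

lemma pos_zero: "0 \<in> pos n"
  and pos_add: "A \<in> pos n \<Longrightarrow> B \<in> pos n \<Longrightarrow> A + B \<in> pos n"
  and pos_mscale: "A \<in> pos n \<Longrightarrow> 0 \<le> c \<Longrightarrow> mscale sc (of_real c) A \<in> pos n"
  using pos_cone by (simp_all add: proper_cone_def zero_fun_def plus_fun_def)

lemma pos_congruence:
  assumes "1 \<le> k" "x \<in> pos k"
  shows "congruence n k X x \<in> pos n"
proof -
  have "smul3 sc n k k n (cstar X) x (cstar (cstar X)) \<in> pos n"
    using matrix_ordered n assms unfolding matrix_ordered_def by blast
  then show ?thesis unfolding congruence_def by (simp add: cstar_def)
qed

lemma pos_closed:
  assumes "\<And>k. f k \<in> pos n" "B \<in> sa_mats st n" "(\<lambda>k. nrm n n (f k - B)) \<longlonglongrightarrow> 0"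
  shows "B \<in> pos n"
proof -
  have "(\<lambda>k. nrm n n (\<lambda>i j. f k i j - B i j)) \<longlonglongrightarrow> 0"
    using assms(3) by (simp add: fun_diff_def)
  then show ?thesis
    using normal n assms(1,2) unfolding normal_mo_star_opspace_def by blast
qed

lemma nrm_between_le:
  assumes "A \<in> sa_mats st n" "B \<in> sa_mats st n" "C \<in> sa_mats st n" "B - A \<in> pos n" "C - B \<in> pos n"
  shows "nrm n n B \<le> max (nrm n n A) (nrm n n C)"
  using normal n assms by (simp add: normal_mo_star_opspace_def fun_diff_def)

end

text \<open>In matrix terms: \<open>Re y \<le> X\<^sup>* x X\<close> for a self-adjoint contraction \<open>x\<close> and
  \<open>Re h + X\<^sup>* X \<le> t\<close>. The scalar variable \<open>h\<close> is there so that a functional below the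
  resulting gauge comes with a positive functional on scalar matrices that controls it.\<close>
definition feasible :: "nat \<Rightarrow> (nat \<Rightarrow> nat \<Rightarrow> complex) \<Rightarrow> (nat \<Rightarrow> nat \<Rightarrow> 'v) \<Rightarrow> real \<Rightarrow> bool" where
  "feasible n h y t \<longleftrightarrow> 0 \<le> t \<and> (\<exists>k X x. 1 \<le> k \<and> x \<in> sa_mats st k \<and> nrm k k x \<le> 1 \<and>
     congruence n k X x - herm_part n y \<in> pos n \<and>
     (\<forall>w. Re (matrix_form n h w w) + (vnorm k (cmat_apply n X w))\<^sup>2 \<le> t * (vnorm n w)\<^sup>2))"

lemma feasibleE:
  assumes "feasible n h y t"
  obtains k X x where "1 \<le> k" "x \<in> sa_mats st k" "nrm k k x \<le> 1"
    "congruence n k X x - herm_part n y \<in> pos n"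
    "\<And>w. Re (matrix_form n h w w) + (vnorm k (cmat_apply n X w))\<^sup>2 \<le> t * (vnorm n w)\<^sup>2"
  using assms unfolding feasible_def by blast

lemma feasible_nonneg: "feasible n h y t \<Longrightarrow> 0 \<le> t"
  unfolding feasible_def by blast

lemma feasibleI:
  assumes "0 \<le> t" and k: "1 \<le> k" and x: "x \<in> sa_mats st k" "nrm k k x \<le> N" and "0 < N"
    and pos: "congruence n k X x - herm_part n y \<in> pos n"
    and bound: "\<And>w. Re (matrix_form n h w w) + N * (vnorm k (cmat_apply n X w))\<^sup>2
        \<le> t * (vnorm n w)\<^sup>2"
  shows "feasible n h y t"
proof -
  define x' where "x' = mscale sc (of_real (1 / N)) x"
  define X' where "X' = mscale (*) (of_real (sqrt N)) X"
  have "x' \<in> sa_mats st k" unfolding x'_def by (rule sa_mats_mscale_real[OF x(1)])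
  moreover have "nrm k k x' \<le> 1"
    unfolding x'_def nrm_mscale[OF k k sa_mats_mats[OF x(1)]] using x(2) \<open>0 < N\<close>
    by (simp add: norm_divide)
  moreover have "congruence n k X' x' = congruence n k X x"
  proof -
    have "cnj (X' p i) * X' q j * of_real (1 / N) = cnj (X p i) * X q j" for p q i j
      using \<open>0 < N\<close> unfolding X'_def mscale_def by (simp add: field_simps flip: of_real_mult)
    then show ?thesis
      unfolding x'_def mscale_def
      by (simp add: fun_eq_iff congruence_apply scale_scale del: of_real_divide)
  qed
  moreover have "(vnorm k (cmat_apply n X' w))\<^sup>2 = N * (vnorm k (cmat_apply n X w))\<^sup>2" for w
  proof -
    have "cmat_apply n X' w p = of_real (sqrt N) * cmat_apply n X w p" for p
      by (simp add: cmat_apply_def X'_def mscale_def sum_distrib_left mult.assoc)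
    then show ?thesis
      using \<open>0 < N\<close> by (simp add: vnorm_sq norm_mult power_mult_distrib sum_distrib_left)
  qed
  ultimately show ?thesis
    unfolding feasible_def using \<open>0 \<le> t\<close> k pos bound
    by (intro conjI exI[of _ k] exI[of _ X'] exI[of _ x']) auto
qed

lemma feasible_if_herm_part_nonpos:
  assumes n: "1 \<le> n" and t: "0 \<le> t" and y: "- herm_part n y \<in> pos n"
    and h: "\<And>w. Re (matrix_form n h w w) \<le> t * (vnorm n w)\<^sup>2"
  shows "feasible n h y t"
proof -
  have "congruence n 1 0 0 = 0" by (simp add: fun_eq_iff congruence_apply)
  then show ?thesis
    using y h by (intro feasibleI[OF t, of 1 0 1 n 0])
      (simp_all add: sa_mats_zero nrm_zero cmat_apply_def vnorm_def)
qed

lemma feasible_add: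
  assumes n: "1 \<le> n" and "feasible n h y t" "feasible n h' y' t'"
  shows "feasible n (h + h') (y + y') (t + t')"
proof -
  obtain k X x where k: "1 \<le> k" and x: "x \<in> sa_mats st k" "nrm k k x \<le> 1"
    and pos: "congruence n k X x - herm_part n y \<in> pos n"
    and bound: "\<And>w. Re (matrix_form n h w w) + (vnorm k (cmat_apply n X w))\<^sup>2 \<le> t * (vnorm n w)\<^sup>2"
    using assms(2) by (rule feasibleE) blast
  obtain k' X' x' where k': "1 \<le> k'" and x': "x' \<in> sa_mats st k'" "nrm k' k' x' \<le> 1"
    and pos': "congruence n k' X' x' - herm_part n y' \<in> pos n"
    and bound': "\<And>w. Re (matrix_form n h' w w) + (vnorm k' (cmat_apply n X' w))\<^sup>2
        \<le> t' * (vnorm n w)\<^sup>2"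
    using assms(3) by (rule feasibleE) blast
  define Z where "Z = (\<lambda>p. if p < k then X p else X' (p - k))"
  have vnorm: "(vnorm (k + k') (cmat_apply n Z w))\<^sup>2
      = (vnorm k (cmat_apply n X w))\<^sup>2 + (vnorm k' (cmat_apply n X' w))\<^sup>2" for w
    unfolding vnorm_sq sum_lessThan_add by (simp add: cmat_apply_def Z_def)
  show ?thesis
  proof (rule feasibleI[where N = 1])
    show "0 \<le> t + t'" using assms(2,3) by (intro add_nonneg_nonneg feasible_nonneg)
    show "dsum k k x x' \<in> sa_mats st (k + k')" by (rule sa_mats_dsum[OF x(1) x'(1)])
    show "nrm (k + k') (k + k') (dsum k k x x') \<le> 1"
      using nrm_dsum[OF k k k' k' sa_mats_mats[OF x(1)] sa_mats_mats[OF x'(1)]] x(2) x'(2) by simp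
    have "congruence n (k + k') Z (dsum k k x x') = congruence n k X x + congruence n k' X' x'"
      unfolding Z_def by (rule congruence_stack_dsum)
    then show "congruence n (k + k') Z (dsum k k x x') - herm_part n (y + y') \<in> pos n"
      using pos_add[OF n pos pos'] by (simp add: herm_part_add algebra_simps)
    show "Re (matrix_form n (h + h') w w) + 1 * (vnorm (k + k') (cmat_apply n Z w))\<^sup>2
        \<le> (t + t') * (vnorm n w)\<^sup>2" for w
      using bound[of w] bound'[of w] unfolding matrix_form.add vnorm by (simp add: algebra_simps)
  qed (use k in simp_all)
qed

lemma feasible_scale:
  assumes n: "1 \<le> n" and c: "0 < c" and "feasible n h y t"
  shows "feasible n (mscale (*) (of_real c) h) (mscale sc (of_real c) y) (c * t)"
proof -
  obtain k X x where k: "1 \<le> k" and x: "x \<in> sa_mats st k" "nrm k k x \<le> 1"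
    and pos: "congruence n k X x - herm_part n y \<in> pos n"
    and bound: "\<And>w. Re (matrix_form n h w w) + (vnorm k (cmat_apply n X w))\<^sup>2 \<le> t * (vnorm n w)\<^sup>2"
    using assms(3) by (rule feasibleE) blast
  show ?thesis
  proof (rule feasibleI[OF _ k _ _ c])
    show "0 \<le> c * t" using c feasible_nonneg[OF assms(3)] by simp
    show "mscale sc (of_real c) x \<in> sa_mats st k" by (rule sa_mats_mscale_real[OF x(1)])
    show "nrm k k (mscale sc (of_real c) x) \<le> c"
      using x(2) c unfolding nrm_mscale[OF k k sa_mats_mats[OF x(1)]] by simp
    have "congruence n k X (mscale sc (of_real c) x) - herm_part n (mscale sc (of_real c) y)
        = mscale sc (of_real c) (congruence n k X x - herm_part n y)"
      unfolding congruence_mscale herm_part_mscale_real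
      by (simp add: mscale_def fun_eq_iff scale_right_diff_distrib)
    then show "congruence n k X (mscale sc (of_real c) x) - herm_part n (mscale sc (of_real c) y) \<in> pos n"
      using pos_mscale[OF n pos] c by simp
    show "Re (matrix_form n (mscale (*) (of_real c) h) w w) + c * (vnorm k (cmat_apply n X w))\<^sup>2
        \<le> c * t * (vnorm n w)\<^sup>2" for w
      using mult_left_mono[OF bound[of w], of c] c unfolding matrix_form.scale
      by (simp add: algebra_simps)
  qed
qed

lemma feasible_exists:
  assumes n: "1 \<le> n"
  shows "\<exists>t. feasible n h y t"
proof -
  define x where "x = herm_part n y"
  define N where "N = nrm n n x + 1"
  define K where "K = frobenius_norm n n h"
  have x: "x \<in> sa_mats st n" unfolding x_def by (rule sa_mats_herm_part)
  have N: "0 < N" using nrm_nonneg[OF n n sa_mats_mats[OF x]] unfolding N_def by simp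
  have "feasible n h y (K + N)"
  proof (rule feasibleI[OF _ n x _ N])
    show "0 \<le> K + N" using N frobenius_norm_nonneg[of n n h] by (simp add: K_def)
    show "nrm n n x \<le> N" unfolding N_def by simp
    show "congruence n n (selection id) x - herm_part n y \<in> pos n"
      using pos_zero[OF n] congruence_selection_id[OF sa_mats_mats[OF x]] by (simp add: x_def)
    show "Re (matrix_form n h w w) + N * (vnorm n (cmat_apply n (selection id) w))\<^sup>2
        \<le> (K + N) * (vnorm n w)\<^sup>2" for w
    proof -
      have "Re (matrix_form n h w w) \<le> K * (vnorm n w)\<^sup>2"
        using complex_Re_le_cmod[of "matrix_form n h w w"] cmod_matrix_form_le[of n h w w]
        unfolding K_def by (simp add: power2_eq_square mult.assoc)
      moreover have "(vnorm n (cmat_apply n (selection id) w))\<^sup>2 \<le> (vnorm n w)\<^sup>2"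
        by (intro power_mono vnorm_selection_le) auto
      then have "N * (vnorm n (cmat_apply n (selection id) w))\<^sup>2 \<le> N * (vnorm n w)\<^sup>2"
        using N by (intro mult_left_mono) auto
      ultimately show ?thesis by (simp add: distrib_right)
    qed
  qed
  then show ?thesis by blast
qed

definition gauge :: "nat \<Rightarrow> (nat \<Rightarrow> nat \<Rightarrow> complex) \<times> (nat \<Rightarrow> nat \<Rightarrow> 'v) \<Rightarrow> real" where
  "gauge n z = Inf {t. feasible n (fst z) (snd z) t}"

lemma gauge_le: "feasible n h y t \<Longrightarrow> gauge n (h, y) \<le> t"
  unfolding gauge_def by (auto intro!: cInf_lower bdd_belowI feasible_nonneg)

lemma gauge_nonneg: "1 \<le> n \<Longrightarrow> 0 \<le> gauge n z"
  unfolding gauge_def using feasible_exists[of n "fst z" "snd z"]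
  by (intro cInf_greatest) (auto intro: feasible_nonneg)

lemma gauge_lessE:
  assumes "1 \<le> n" "gauge n (h, y) < t"
  obtains u where "u < t" "feasible n h y u"
  using cInf_lessD[of "{t. feasible n h y t}" t] feasible_exists[OF assms(1), of h y] assms(2)
  unfolding gauge_def by auto

sublocale pair: vector_space_prod "mscale (*)" "mscale sc"
  by (intro vector_space_prod.intro vector_space_pair.intro vector_space_mscale
      vector_space_over_itself.vector_space_axioms vector_space_axioms)

lemma sublinear_functional_gauge:
  assumes n: "1 \<le> n"
  shows "sublinear_functional (\<lambda>r. pair.scale (of_real r)) (gauge n)"
proof (rule sublinear_functionalI)
  have gauge: "gauge n z = (INF t\<in>{t. feasible n (fst z) (snd z) t}. t)" for z
    unfolding gauge_def by simp
  have nonempty: "{t. feasible n (fst z) (snd z) t} \<noteq> {}" for z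
    using feasible_exists[OF n] by simp
  show "gauge n (z + z') \<le> gauge n z + gauge n z'" for z z'
    unfolding gauge[of z] gauge[of z']
  proof (rule le_add_cINF[OF nonempty nonempty])
    show "gauge n (z + z') \<le> t + t'"
      if "t \<in> {t. feasible n (fst z) (snd z) t}" "t' \<in> {t. feasible n (fst z') (snd z') t}" for t t'
      using gauge_le[OF feasible_add[OF n]] that by (simp add: plus_prod_def)
  qed
  show "gauge n (pair.scale (of_real c) z) \<le> c * gauge n z" if c: "0 < c" for c z
    unfolding gauge[of z]
  proof (rule le_mult_cINF[OF nonempty c])
    show "gauge n (pair.scale (of_real c) z) \<le> c * t"
      if "t \<in> {t. feasible n (fst z) (snd z) t}" for t
      using gauge_le[OF feasible_scale[OF n c]] that by (simp add: pair.scale_def)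
  qed
  have "feasible n 0 0 0"
    using n pos_zero[OF n] herm_part_sa[OF sa_mats_zero]
    by (intro feasible_if_herm_part_nonpos) (simp_all add: matrix_form_def cmat_apply_def)
  then show "gauge n 0 = 0"
    using gauge_le[of n 0 0 0] gauge_nonneg[OF n, of 0] by (simp add: zero_prod_def)
qed (rule vector_space_of_real_scale[OF pair.p.vector_space_axioms])

lemma feasible_zero_leftE:
  assumes n: "1 \<le> n" and y: "y \<in> sa_mats st n" and feasible: "feasible n 0 y t"
  obtains z where "z \<in> sa_mats st n" "nrm n n z \<le> t" "z - y \<in> pos n"
proof -
  obtain k X x where k: "1 \<le> k" and x: "x \<in> sa_mats st k" "nrm k k x \<le> 1"
    and pos: "congruence n k X x - herm_part n y \<in> pos n"
    and bound: "\<And>w. Re (matrix_form n 0 w w) + (vnorm k (cmat_apply n X w))\<^sup>2 \<le> t * (vnorm n w)\<^sup>2"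
    using feasible by (rule feasibleE) blast
  have t: "0 \<le> t" using feasible_nonneg[OF feasible] .
  have "vnorm k (cmat_apply n X w) \<le> sqrt t * vnorm n w" for w
  proof (rule power2_le_imp_le)
    show "(vnorm k (cmat_apply n X w))\<^sup>2 \<le> (sqrt t * vnorm n w)\<^sup>2"
      using bound[of w] t by (simp add: matrix_form_def cmat_apply_def power_mult_distrib)
  qed (use t in simp)
  then have "nrm n n (congruence n k X x) \<le> t * nrm k k x"
    using nrm_congruence_le[OF n k sa_mats_mats[OF x(1)], of "sqrt t" X] t by simp
  also have "\<dots> \<le> t" using x(2) t by (simp add: mult_left_le)
  finally show ?thesis
    using that[OF sa_mats_congruence[OF x(1)]] pos by (simp add: herm_part_sa[OF y])
qed

text \<open>Here normality enters: a self-adjoint \<open>A\<close> lies between matrices of norm close to the two gauges.\<close>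
lemma nrm_le_gauge:
  assumes n: "1 \<le> n" and A: "A \<in> sa_mats st n"
  shows "nrm n n A \<le> max (gauge n (0, A)) (gauge n (0, - A))"
proof (rule field_le_epsilon)
  fix e :: real assume e: "0 < e"
  obtain t where t: "t < gauge n (0, A) + e" "feasible n 0 A t"
    using gauge_lessE[OF n, of 0 A] e by (metis less_add_same_cancel1)
  obtain t' where t': "t' < gauge n (0, - A) + e" "feasible n 0 (- A) t'"
    using gauge_lessE[OF n, of 0 "- A"] e by (metis less_add_same_cancel1)
  obtain z where z: "z \<in> sa_mats st n" "nrm n n z \<le> t" "z - A \<in> pos n"
    using feasible_zero_leftE[OF n A t(2)] .
  obtain z' where z': "z' \<in> sa_mats st n" "nrm n n z' \<le> t'" "z' - (- A) \<in> pos n"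
    using feasible_zero_leftE[OF n sa_mats_uminus[OF A] t'(2)] .
  have "A - (- z') \<in> pos n" using z'(3) by (simp add: add.commute)
  then have "nrm n n A \<le> max (nrm n n (- z')) (nrm n n z)"
    by (rule nrm_between_le[OF n sa_mats_uminus[OF z'(1)] A z(1) _ z(3)])
  also have "\<dots> \<le> max t' t"
    using z(2) z'(2) unfolding nrm_uminus[OF n n sa_mats_mats[OF z'(1)]] by auto
  finally show "nrm n n A \<le> max (gauge n (0, A)) (gauge n (0, - A)) + e" using t(1) t'(1) by auto
qed

lemma pos_if_gauge_uminus_zero:
  assumes n: "1 \<le> n" and A: "A \<in> sa_mats st n" and "gauge n (0, - A) = 0"
  shows "A \<in> pos n"
proof -
  have "\<exists>z. z \<in> sa_mats st n \<and> nrm n n z \<le> inverse (real (Suc k)) \<and> z + A \<in> pos n" for k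
  proof -
    obtain t where t: "t < inverse (real (Suc k))" "feasible n 0 (- A) t"
      using gauge_lessE[OF n, of 0 "- A" "inverse (real (Suc k))"] assms(3) by auto
    obtain z where "z \<in> sa_mats st n" "nrm n n z \<le> t" "z - (- A) \<in> pos n"
      using feasible_zero_leftE[OF n sa_mats_uminus[OF A] t(2)] .
    then show ?thesis using t(1) by (intro exI[of _ z]) simp
  qed
  then obtain z where z: "\<And>k. z k \<in> sa_mats st n" "\<And>k. nrm n n (z k) \<le> inverse (real (Suc k))"
    "\<And>k. z k + A \<in> pos n" by metis
  have "(\<lambda>k. nrm n n (z k)) \<longlonglongrightarrow> 0"
    by (rule tendsto_sandwich[OF _ _ tendsto_const LIMSEQ_inverse_real_of_nat])
       (use z(2) nrm_nonneg[OF n n sa_mats_mats[OF z(1)]] in auto)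
  then show ?thesis by (intro pos_closed[OF n z(3) A]) simp
qed

end

section \<open>Functionals below the gauge\<close>

context normal_space
begin

lemma norming_functionals_exist:
  assumes n: "1 \<le> n"
  obtains p F where "Vector_Spaces.linear (mscale (*)) (*) p"
    "Vector_Spaces.linear (mscale sc) (*) F"
    "\<And>h y t. feasible n h y t \<Longrightarrow> Re (p h) + Re (F y) \<le> t" "Re (F A) = gauge n (0, A)"
proof -
  obtain f where linear: "Vector_Spaces.linear (\<lambda>r. pair.scale (of_real r)) (*) f"
    and below: "f \<le> gauge n" and attained: "f (0, A) = gauge n (0, A)"
    using sublinear_functional.hahn_banach[OF sublinear_functional_gauge[OF n]] by blast
  define G where "G z = Complex (f z) (- f (pair.scale \<i> z))" for z
  interpret G: Vector_Spaces.linear pair.scale "(*)" G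
    unfolding G_def by (rule linear_complexification[OF pair.p.vector_space_axioms linear])
  show ?thesis
  proof (rule that[of "\<lambda>h. G (h, 0)" "\<lambda>y. G (0, y)"])
    show "Vector_Spaces.linear (mscale (*)) (*) (\<lambda>h. G (h, 0))"
      unfolding Vector_Spaces.linear_iff
      by (intro conjI allI pair.vs1.vector_space_axioms
          vector_space_over_itself.vector_space_axioms)
         (simp_all add: G.add[symmetric] G.scale[symmetric] pair.scale_prod)
    show "Vector_Spaces.linear (mscale sc) (*) (\<lambda>y. G (0, y))"
      unfolding Vector_Spaces.linear_iff
      by (intro conjI allI pair.vs2.vector_space_axioms
          vector_space_over_itself.vector_space_axioms)
         (simp_all add: G.add[symmetric] G.scale[symmetric] pair.scale_prod)
    show "Re (G (h, 0)) + Re (G (0, y)) \<le> t" if "feasible n h y t" for h y t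
    proof -
      have "Re (G (h, 0)) + Re (G (0, y)) = Re (G ((h, 0) + (0, y)))" unfolding G.add by simp
      also have "\<dots> \<le> gauge n (h, y)" using le_funD[OF below, of "(h, y)"] by (simp add: G_def)
      finally show ?thesis using gauge_le[OF that] by simp
    qed
    show "Re (G (0, A)) = gauge n (0, A)" using attained by (simp add: G_def)
  qed
qed

end

locale dominated_functionals = normal_space sc st nrm pos
  for sc :: "complex \<Rightarrow> 'v::ab_group_add \<Rightarrow> 'v" and st nrm pos +
  fixes n :: nat and p :: "(nat \<Rightarrow> nat \<Rightarrow> complex) \<Rightarrow> complex" and F :: "(nat \<Rightarrow> nat \<Rightarrow> 'v) \<Rightarrow> complex"
  assumes n: "1 \<le> n"
    and linear_p: "Vector_Spaces.linear (mscale (*)) (*) p"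
    and linear_F: "Vector_Spaces.linear (mscale sc) (*) F"
    and dominated: "feasible n h y t \<Longrightarrow> Re (p h) + Re (F y) \<le> t"
begin

sublocale p: Vector_Spaces.linear "mscale (*)" "(*)" p by (rule linear_p)
sublocale F: Vector_Spaces.linear "mscale sc" "(*)" F by (rule linear_F)

lemma p_le: "0 \<le> t \<Longrightarrow> (\<And>w. Re (matrix_form n h w w) \<le> t * (vnorm n w)\<^sup>2) \<Longrightarrow> Re (p h) \<le> t"
  using dominated[OF feasible_if_herm_part_nonpos[OF n, of t 0 h]] pos_zero[OF n]
      herm_part_sa[OF sa_mats_zero]
  by (simp add: F.zero)

lemma F_le_zero: "- herm_part n y \<in> pos n \<Longrightarrow> Re (F y) \<le> 0"
  using dominated[OF feasible_if_herm_part_nonpos[OF n, of 0 y 0]]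
  by (simp add: p.zero matrix_form_def cmat_apply_def)

lemma p_cstar: "p (cstar h) = cnj (p h)"
  unfolding cstar_eq_mstar
proof (rule star_space.linear_functional_star_eq_cnj[OF scalar.star_space_matrices linear_p])
  fix h
  show "Re (p (h - mstar cnj h)) \<le> 0"
    by (rule p_le) (simp_all add: matrix_form.diff matrix_form_cstar flip: cstar_eq_mstar)
qed

lemma F_mstar: "F (mstar st y) = cnj (F y)"
proof (rule star_space.linear_functional_star_eq_cnj[OF star_space_matrices linear_F])
  show "Re (F (y - mstar st y)) \<le> 0" for y
    using pos_zero[OF n] by (intro F_le_zero) (simp add: herm_part_diff_mstar)
qed

definition scalar_form :: "(nat \<Rightarrow> complex) \<Rightarrow> (nat \<Rightarrow> complex) \<Rightarrow> complex" where
  "scalar_form a b = p (scalar.rank_one n 1 a b)"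

definition vector_form :: "'v \<Rightarrow> (nat \<Rightarrow> complex) \<Rightarrow> (nat \<Rightarrow> complex) \<Rightarrow> complex" where
  "vector_form v a b = F (rank_one n v a b)"

lemma amplification_vector_form: "amplification vector_form k k x X X = F (congruence n k X x)"
  unfolding amplification_def vector_form_def congruence_eq_sum_rank_one by (simp add: F.sum)

lemma hermitian_form_family_vector_form: "hermitian_form_family sc st vector_form"
proof unfold_locales
  show "vector_form (v + w) a b = vector_form v a b + vector_form w a b" for v w a b
    unfolding vector_form_def rank_one_add_vec F.add ..
  show "vector_form (sc c v) a b = c * vector_form v a b" for c v a b
    unfolding vector_form_def rank_one_scale_vec F.scale ..
  show "vector_form (st v) b a = cnj (vector_form v a b)" for v a b
    unfolding vector_form_def F_mstar[symmetric] mstar_rank_one ..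
qed

lemma sum_scalar_form_le:
  assumes "0 \<le> t" and bounded: "\<And>w. (vnorm k (cmat_apply n X w))\<^sup>2 \<le> t * (vnorm n w)\<^sup>2"
  shows "(\<Sum>p<k. Re (scalar_form (X p) (X p))) \<le> t"
proof -
  have "Re (p (\<Sum>p<k. scalar.rank_one n 1 (X p) (X p))) \<le> t"
    using bounded
    by (intro p_le[OF \<open>0 \<le> t\<close>])
       (simp add: matrix_form.sum matrix_form_rank_one vnorm_sq cmat_apply_def)
  then show ?thesis unfolding scalar_form_def p.sum by simp
qed

lemma Re_amplification_vector_form_le:
  assumes k: "1 \<le> k" and x: "x \<in> sa_mats st k"
  shows "Re (amplification vector_form k k x X X)
      \<le> nrm k k x * (\<Sum>p<k. Re (scalar_form (X p) (X p)))"
proof (cases "x = 0")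
  case True
  interpret vector_form: hermitian_form_family sc st vector_form
    by (rule hermitian_form_family_vector_form)
  show ?thesis unfolding True by (simp add: vector_form.amplification_zero nrm_zero[OF k k])
next
  case False
  define N where "N = nrm k k x"
  have "0 < N"
    using False nrm_nonneg[OF k k sa_mats_mats[OF x]] nrm_eq_0_iff[OF k k sa_mats_mats[OF x]]
    unfolding N_def by simp
  define h where "h = mscale (*) (of_real (- N)) (\<Sum>p<k. scalar.rank_one n 1 (X p) (X p))"
  have matrix_form_h: "Re (matrix_form n h w w) = - N * (vnorm k (cmat_apply n X w))\<^sup>2" for w
    unfolding h_def matrix_form.scale matrix_form.sum matrix_form_rank_one vnorm_sq cmat_apply_def by simp
  have "feasible n h (congruence n k X x) 0"
  proof (rule feasibleI[OF _ k x _ \<open>0 < N\<close>])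
    show "congruence n k X x - herm_part n (congruence n k X x) \<in> pos n"
      using pos_zero[OF n] by (simp add: herm_part_sa[OF sa_mats_congruence[OF x]])
  qed (simp_all add: N_def matrix_form_h)
  then have "Re (p h) + Re (F (congruence n k X x)) \<le> 0" by (rule dominated)
  moreover have "Re (p h) = - N * (\<Sum>p<k. Re (scalar_form (X p) (X p)))"
    unfolding h_def p.scale p.sum scalar_form_def by simp
  ultimately show ?thesis by (simp add: amplification_vector_form N_def)
qed

lemma Re_amplification_vector_form_nonneg:
  assumes "1 \<le> k" "x \<in> pos k"
  shows "0 \<le> Re (amplification vector_form k k x X X)"
proof -
  let ?y = "congruence n k X x"
  have "?y \<in> pos n" by (rule pos_congruence[OF n assms])
  moreover then have "herm_part n (- ?y) = - ?y"
    using pos_sa_mats[OF n] by (intro herm_part_sa sa_mats_uminus)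
  ultimately have "Re (F (- ?y)) \<le> 0" by (intro F_le_zero) simp
  then show ?thesis by (simp add: amplification_vector_form F.neg)
qed

lemma semi_inner_product_scalar_form: "semi_inner_product vec_scale scalar_form"
proof -
  interpret scalar_form: sesquilinear_form vec_scale scalar_form
    unfolding scalar_form_def by (rule scalar.sesquilinear_form_rank_one[OF linear_p])
  show ?thesis
  proof unfold_locales
    show "cnj (scalar_form a b) = scalar_form b a" for a b
      unfolding scalar_form_def p_cstar[symmetric] cstar_eq_mstar scalar.mstar_rank_one by simp
    show "0 \<le> Re (scalar_form a a)" for a
    proof -
      have "Re (p (- scalar.rank_one n 1 a a)) \<le> 0"
        by (rule p_le) (simp_all add: matrix_form.neg matrix_form_rank_one)
      then show ?thesis by (simp add: p.neg scalar_form_def)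
    qed
  qed
qed

end

section \<open>Completely contractive, completely positive maps into matrix algebras\<close>

definition map_form :: "nat \<Rightarrow> ('v \<Rightarrow> nat \<Rightarrow> nat \<Rightarrow> complex) \<Rightarrow> 'v \<Rightarrow> (nat \<Rightarrow> complex) \<Rightarrow> (nat \<Rightarrow> complex)
    \<Rightarrow> complex"
  where "map_form d \<phi> v = matrix_form d (\<phi> v)"

context normal_space
begin

text \<open>Completely contractive and completely positive maps into the d x d matrices; entries of \<open>\<phi> v\<close>
  outside the index range are constrained only by linearity and symmetry.\<close>
definition ccp_map :: "('v \<Rightarrow> nat \<Rightarrow> nat \<Rightarrow> complex) \<Rightarrow> nat \<Rightarrow> bool" where
  "ccp_map \<phi> d \<longleftrightarrow> (\<forall>r s. Vector_Spaces.linear sc (*) (\<lambda>v. \<phi> v r s)) \<and> (\<forall>v. \<phi> (st v) = cstar (\<phi> v)) \<and>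
     (\<forall>n A \<xi>. 1 \<le> n \<longrightarrow> A \<in> pos n \<longrightarrow> 0 \<le> Re (amplification (map_form d \<phi>) n n A \<xi> \<xi>)) \<and>
     (\<forall>n m A \<eta> \<xi>. 1 \<le> n \<longrightarrow> 1 \<le> m \<longrightarrow> A \<in> mats n m \<longrightarrow>
        cmod (amplification (map_form d \<phi>) n m A \<eta> \<xi>)
          \<le> nrm n m A * (hn_norm {..<d} n \<eta> * hn_norm {..<d} m \<xi>))"

end

locale dominated_form_family =
  normal_space sc st nrm pos + P: semi_inner_product scale P + B: hermitian_form_family sc st B
  for sc :: "complex \<Rightarrow> 'v::ab_group_add \<Rightarrow> 'v" and st nrm pos
    and scale :: "complex \<Rightarrow> 'b::ab_group_add \<Rightarrow> 'b" and P B +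
  assumes sesquilinear: "sesquilinear_form scale (B v)"
    and Re_amplification_le: "1 \<le> k \<Longrightarrow> x \<in> sa_mats st k \<Longrightarrow>
      Re (amplification B k k x a a) \<le> nrm k k x * P.sq_sum k a"
    and Re_amplification_nonneg: "1 \<le> k \<Longrightarrow> x \<in> pos k \<Longrightarrow> 0 \<le> Re (amplification B k k x a a)"
begin

sublocale B: sesquilinear_form scale "B v" for v by (rule sesquilinear)

text \<open>The bound for self-adjoint matrices is applied to \<open>sa_dilation k x\<close> with the vectors rescaled by
  \<open>sqrt r\<close> and \<open>1 / sqrt r\<close>.\<close>
lemma Re_amplification_le_weighted:
  assumes k: "1 \<le> k" and l: "1 \<le> l" and x: "x \<in> mats k l" and r: "0 < r"
  shows "2 * Re (amplification B k l x a b)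
    \<le> r * (nrm k l x * P.sq_sum k a) + nrm k l x * P.sq_sum l b / r"
proof -
  define c where "c p = (if p < k then scale (of_real (sqrt r)) (a p)
    else scale (of_real (1 / sqrt r)) (b (p - k)))" for p
  have "amplification B k l x c (\<lambda>q. c (k + q)) = amplification B k l x a b"
    unfolding amplification_def c_def using r by (simp add: B.scale_left B.scale_right)
  moreover have "Re (P (c p) (c p)) = r * Re (P (a p) (a p))" if "p < k" for p
    using r that unfolding c_def
    by (simp add: P.scale_left P.scale_right mult.assoc[symmetric] flip: of_real_mult)
  moreover have "Re (P (c (k + q)) (c (k + q))) = Re (P (b q) (b q)) / r" for q
    using r unfolding c_def
    by (simp add: P.scale_left P.scale_right flip: of_real_mult)
  ultimately show ?thesis
    using Re_amplification_le[OF _ sa_mats_sa_dilation[OF x], of c] k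
    by (simp add: B.amplification_sa_dilation nrm_sa_dilation[OF k l x] P.sq_sum_def
        sum_lessThan_add sum_distrib_left sum_divide_distrib algebra_simps)
qed

lemma amplification_Cauchy_Schwarz:
  assumes k: "1 \<le> k" and l: "1 \<le> l" and x: "x \<in> mats k l"
  shows "cmod (amplification B k l x a b)
    \<le> nrm k l x * (sqrt (P.sq_sum k a) * sqrt (P.sq_sum l b))"
proof -
  define S where "S = P.sq_sum k a"
  define T where "T = P.sq_sum l b"
  define Z where "Z = amplification B k l x a b"
  define \<omega> where "\<omega> = cis (Arg Z)"
  have unimodular: "cnj \<omega> * \<omega> = 1" "\<omega> * cnj \<omega> = 1" unfolding \<omega>_def
    by (simp_all add: cis_cnj cis_mult)
  have "of_real (cmod Z) * \<omega> = Z"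
    using rcis_cmod_Arg[of Z] by (simp add: rcis_def \<omega>_def)
  then have \<omega>: "cnj \<omega> * Z = of_real (cmod Z)"
    using unimodular(1) by (metis mult.left_commute mult.right_neutral)
  have nonneg: "0 \<le> nrm k l x" "0 \<le> S" "0 \<le> T"
    unfolding S_def T_def by (simp_all add: nrm_nonneg[OF k l x] P.sq_sum_nonneg)
  have "2 * cmod Z \<le> r * (nrm k l x * S) + nrm k l x * T / r" if "0 < r" for r
  proof -
    have "amplification B k l x (\<lambda>p. scale \<omega> (a p)) b = cnj \<omega> * Z"
      unfolding Z_def amplification_def by (simp add: B.scale_left sum_distrib_left)
    moreover have "P (scale \<omega> (a p)) (scale \<omega> (a p)) = P (a p) (a p)" for p
      unfolding P.scale_left P.scale_right by (simp add: unimodular flip: mult.assoc)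
    ultimately show ?thesis
      using Re_amplification_le_weighted[OF k l x that, of "\<lambda>p. scale \<omega> (a p)" b]
      unfolding \<omega> S_def T_def P.sq_sum_def by simp
  qed
  then have "cmod Z \<le> sqrt (nrm k l x * S) * sqrt (nrm k l x * T)"
    using nonneg by (intro le_sqrt_mult_sqrt) auto
  also have "\<dots> = nrm k l x * (sqrt S * sqrt T)"
    using nonneg by (simp add: real_sqrt_mult)
  finally show ?thesis unfolding Z_def S_def T_def .
qed

lemma null_form:
  assumes "P.null z"
  shows "B v z b = 0" "B v b z = 0"
proof -
  have left: "B v z b = 0" for v
  proof -
    have "(\<lambda>i j. if i = 0 \<and> j = 0 then v else 0) \<in> mats 1 1" unfolding mats_def by auto
    from amplification_Cauchy_Schwarz[OF order_refl order_refl this,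
        of "\<lambda>_. z" "\<lambda>_. b"] show ?thesis
      using assms by (simp add: amplification_def P.sq_sum_def P.null_def)
  qed
  show "B v z b = 0" by (rule left)
  show "B v b z = 0" using B.form_st[of "st v" b z] left[of "st v"] by simp
qed

context
  fixes d :: nat and u :: "nat \<Rightarrow> 'b"
  assumes orthonormal: "P.orthonormal d u"
begin

definition synthesis :: "(nat \<Rightarrow> complex) \<Rightarrow> 'b" where
  "synthesis c = (\<Sum>r<d. scale (c r) (u r))"

definition compression :: "'v \<Rightarrow> nat \<Rightarrow> nat \<Rightarrow> complex" where
  "compression v = (\<lambda>r s. B v (u r) (u s))"

lemma map_form_compression: "map_form d compression v a b = B v (synthesis a) (synthesis b)"
proof -
  have "B v (synthesis a) (synthesis b) = (\<Sum>r<d. cnj (a r) * B v (u r) (synthesis b))"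
    unfolding synthesis_def[of a] by (rule B.sum_left)
  also have "\<dots> = (\<Sum>r<d. cnj (a r) * (\<Sum>s<d. b s * B v (u r) (u s)))"
    unfolding synthesis_def B.sum_right ..
  finally show ?thesis
    by (simp add: map_form_def matrix_form_def cmat_apply_def compression_def mult.commute)
qed

lemma hn_norm_eq_synthesis: "hn_norm {..<d} n \<xi> = sqrt (P.sq_sum n (\<lambda>i. synthesis (\<xi> i)))"
  by (simp add: hn_norm_def l2norm_lessThan vnorm_sq P.sq_sum_def synthesis_def
      P.parseval[OF orthonormal])

lemma ccp_map_compression: "ccp_map compression d"
proof -
  have amplification: "amplification (map_form d compression) n m A \<eta> \<xi>
      = amplification B n m A (\<lambda>i. synthesis (\<eta> i)) (\<lambda>i. synthesis (\<xi> i))" for n m A \<eta> \<xi>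
    by (simp add: amplification_def map_form_compression)
  show ?thesis
    unfolding ccp_map_def amplification hn_norm_eq_synthesis
    using B.linear_form B.form_st Re_amplification_nonneg amplification_Cauchy_Schwarz
    by (simp add: compression_def cstar_def)
qed

lemma form_synthesis_coordinates:
  assumes "P.null (P.residual d u a)" "P.null (P.residual d u b)"
  shows "B v (synthesis (\<lambda>r. P (u r) a)) (synthesis (\<lambda>r. P (u r) b)) = B v a b"
proof -
  have "synthesis (\<lambda>r. P (u r) y) = y - P.residual d u y" for y
    by (simp add: synthesis_def P.residual_def)
  then show ?thesis
    by (simp add: B.diff_left B.diff_right null_form[OF assms(1)] null_form[OF assms(2)])
qed

end

lemma ccp_map_attaining_amplification:
  assumes "P.sq_sum n e \<le> 1"
  obtains \<phi> d \<xi> where "ccp_map \<phi> d" "hn_norm {..<d} n \<xi> \<le> 1"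
    "amplification (map_form d \<phi>) n n A \<xi> \<xi> = amplification B n n A e e"
proof -
  obtain d u where orthonormal: "P.orthonormal d u"
    and null: "\<And>i. i < n \<Longrightarrow> P.null (P.residual d u (e i))"
    using P.gram_schmidt[of n e] by blast
  define \<xi> where "\<xi> i r = P (u r) (e i)" for i r
  have "(hn_norm {..<d} n \<xi>)\<^sup>2 \<le> P.sq_sum n e"
    unfolding hn_norm_lessThan_sq P.sq_sum_def \<xi>_def
    by (intro sum_mono P.bessel_ineq[OF orthonormal])
  also have "\<dots> \<le> 1\<^sup>2" using assms by simp
  finally have "hn_norm {..<d} n \<xi> \<le> 1" by (rule power2_le_imp_le) simp
  moreover have "amplification (map_form d (compression u)) n n A \<xi> \<xi> = amplification B n n A e e"
    unfolding amplification_def map_form_compression[OF orthonormal] \<xi>_def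
    by (intro sum.cong refl form_synthesis_coordinates orthonormal null) auto
  ultimately show ?thesis by (rule that[OF ccp_map_compression[OF orthonormal]])
qed

end

sublocale dominated_functionals \<subseteq> forms: dominated_form_family sc st nrm pos
    vec_scale scalar_form vector_form
proof (intro dominated_form_family.intro dominated_form_family_axioms.intro)
  show "sesquilinear_form vec_scale (vector_form v)" for v
    unfolding vector_form_def by (rule sesquilinear_form_rank_one[OF linear_F])
  show "1 \<le> k \<Longrightarrow> x \<in> sa_mats st k \<Longrightarrow> Re (amplification vector_form k k x a a)
      \<le> nrm k k x * semi_inner_product.sq_sum scalar_form k a" for k x a
    unfolding semi_inner_product.sq_sum_def[OF semi_inner_product_scalar_form]
    by (rule Re_amplification_vector_form_le)
qed (fact normal_space_axioms semi_inner_product_scalar_form hermitian_form_family_vector_form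
    Re_amplification_vector_form_nonneg)+

context normal_space
begin

theorem ccp_map_attaining_gauge:
  assumes n: "1 \<le> n" and A: "A \<in> mats n n"
  obtains \<phi> d \<xi> where "ccp_map \<phi> d" "hn_norm {..<d} n \<xi> \<le> 1"
    "Re (amplification (map_form d \<phi>) n n A \<xi> \<xi>) = gauge n (0, A)"
proof -
  obtain p F where linear: "Vector_Spaces.linear (mscale (*)) (*) p"
      "Vector_Spaces.linear (mscale sc) (*) F"
    and dominated: "\<And>h y t. feasible n h y t \<Longrightarrow> Re (p h) + Re (F y) \<le> t"
    and norming: "Re (F A) = gauge n (0, A)"
    using norming_functionals_exist[OF n] by blast
  interpret dominated_functionals sc st nrm pos n p F
    by (intro dominated_functionals.intro dominated_functionals_axioms.intro normal_space_axioms
        n linear dominated)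
  have "(vnorm n (cmat_apply n (selection id) w))\<^sup>2 \<le> 1 * (vnorm n w)\<^sup>2" for w
    using vnorm_selection_le[of id n n w] by (simp add: power_mono)
  then have "forms.P.sq_sum n (selection id) \<le> 1"
    unfolding forms.P.sq_sum_def by (intro sum_scalar_form_le) auto
  then obtain \<phi> d \<xi> where "ccp_map \<phi> d" "hn_norm {..<d} n \<xi> \<le> 1"
    "amplification (map_form d \<phi>) n n A \<xi> \<xi>
        = amplification vector_form n n A (selection id) (selection id)"
    by (rule forms.ccp_map_attaining_amplification)
  moreover have "Re (amplification vector_form n n A (selection id) (selection id))
      = gauge n (0, A)"
    unfolding amplification_vector_form congruence_selection_id[OF A] by (rule norming)
  ultimately show ?thesis using that[of \<phi> d \<xi>] by (simp only:)
qed

end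

section \<open>The universal block diagonal representation\<close>

lemma amplification_map_form_eq_hn_inner:
  "amplification (map_form d \<phi>) n m A \<eta> \<xi>
    = hn_inner {..<d} n (opmat_apply m (\<lambda>i j. cmat_apply d (\<phi> (A i j))) \<xi>) \<eta>"
proof -
  have "(\<Sum>j<m. matrix_form d (\<phi> (A i j)) (\<eta> i) (\<xi> j))
      = (\<Sum>r<d. (\<Sum>j<m. cmat_apply d (\<phi> (A i j)) (\<xi> j) r) * cnj (\<eta> i r))" for i
    unfolding matrix_form_def sum_distrib_right by (subst sum.swap) (simp add: mult.commute)
  then show ?thesis
    unfolding amplification_def map_form_def hn_inner_lessThan opmat_apply_def by simp
qed

context normal_space
begin

lemma hermitian_form_family_ccp_map:
  assumes "ccp_map \<phi> d"
  shows "hermitian_form_family sc st (map_form d \<phi>)"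
proof -
  have linear: "Vector_Spaces.linear sc (*) (\<lambda>v. \<phi> v r s)"
    and star: "\<phi> (st v) = cstar (\<phi> v)" for r s v
    using assms unfolding ccp_map_def by blast+
  have "\<phi> (v + w) = \<phi> v + \<phi> w" "\<phi> (sc c v) = mscale (*) c (\<phi> v)" for c v w
    using linear unfolding Vector_Spaces.linear_iff mscale_def by (auto simp: fun_eq_iff)
  then show ?thesis
    by unfold_locales
        (simp_all add: map_form_def matrix_form.add matrix_form.scale matrix_form_cstar star)
qed

lemma Re_amplification_ccp_map_nonneg:
  "ccp_map \<phi> d \<Longrightarrow> 1 \<le> n \<Longrightarrow> A \<in> pos n \<Longrightarrow> 0 \<le> Re (amplification (map_form d \<phi>) n n A \<xi> \<xi>)"
  unfolding ccp_map_def by blast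

text \<open>Pairing the image vector with itself turns the bound on forms into a bound on operators.\<close>
lemma hn_norm_ccp_map_apply_le:
  assumes "ccp_map \<phi> d" "1 \<le> n" "1 \<le> m" "A \<in> mats n m"
  shows "hn_norm {..<d} n (opmat_apply m (\<lambda>i j. cmat_apply d (\<phi> (A i j))) \<xi>)
      \<le> nrm n m A * hn_norm {..<d} m \<xi>"
proof -
  define y where "y = opmat_apply m (\<lambda>i j. cmat_apply d (\<phi> (A i j))) \<xi>"
  define a where "a = hn_norm {..<d} n y"
  have "cmod (amplification (map_form d \<phi>) n m A y \<xi>) \<le> nrm n m A * (a * hn_norm {..<d} m \<xi>)"
    using assms unfolding ccp_map_def a_def by blast
  then have "a * a \<le> a * (nrm n m A * hn_norm {..<d} m \<xi>)"
    unfolding amplification_map_form_eq_hn_inner y_def[symmetric] hn_inner_self_lessThan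
    by (simp add: a_def power2_eq_square norm_mult ac_simps)
  moreover have "0 \<le> a" "0 \<le> nrm n m A * hn_norm {..<d} m \<xi>"
    using nrm_nonneg[OF assms(2-4)] by (simp_all add: a_def)
  ultimately have "a \<le> nrm n m A * hn_norm {..<d} m \<xi>"
    by (cases "a = 0") (simp_all add: mult_le_cancel_left_pos less_le)
  then show ?thesis unfolding a_def y_def .
qed

lemma nrm_le_if_ccp_maps_le:
  assumes n: "1 \<le> n" and A: "A \<in> sa_mats st n"
    and bounded: "\<And>\<phi> d \<xi>. ccp_map \<phi> d \<Longrightarrow> hn_norm {..<d} n \<xi> \<le> 1 \<Longrightarrow>
      \<bar>Re (amplification (map_form d \<phi>) n n A \<xi> \<xi>)\<bar> \<le> M"
  shows "nrm n n A \<le> M"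
proof -
  obtain \<phi> d \<xi> where "ccp_map \<phi> d" "hn_norm {..<d} n \<xi> \<le> 1"
    "Re (amplification (map_form d \<phi>) n n A \<xi> \<xi>) = gauge n (0, A)"
    using ccp_map_attaining_gauge[OF n sa_mats_mats[OF A]] .
  then have "gauge n (0, A) \<le> M" using bounded[of \<phi> d \<xi>] by simp
  obtain \<phi> d \<xi> where ccp: "ccp_map \<phi> d" "hn_norm {..<d} n \<xi> \<le> 1"
    and attained: "Re (amplification (map_form d \<phi>) n n (- A) \<xi> \<xi>) = gauge n (0, - A)"
    using ccp_map_attaining_gauge[OF n sa_mats_mats[OF sa_mats_uminus[OF A]]] .
  interpret hermitian_form_family sc st "map_form d \<phi>"
    by (rule hermitian_form_family_ccp_map[OF ccp(1)])
  have "gauge n (0, - A) \<le> M"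
    using bounded[OF ccp] attained by (simp add: amplification_uminus)
  then show ?thesis using \<open>gauge n (0, A) \<le> M\<close> nrm_le_gauge[OF n A] by simp
qed

lemma pos_if_ccp_maps_nonneg:
  assumes n: "1 \<le> n" and A: "A \<in> sa_mats st n"
    and nonneg: "\<And>\<phi> d \<xi>. ccp_map \<phi> d \<Longrightarrow> 0 \<le> Re (amplification (map_form d \<phi>) n n A \<xi> \<xi>)"
  shows "A \<in> pos n"
proof -
  obtain \<phi> d \<xi> where ccp: "ccp_map \<phi> d"
    and attained: "Re (amplification (map_form d \<phi>) n n (- A) \<xi> \<xi>) = gauge n (0, - A)"
    using ccp_map_attaining_gauge[OF n sa_mats_mats[OF sa_mats_uminus[OF A]]] .
  interpret hermitian_form_family sc st "map_form d \<phi>"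
    by (rule hermitian_form_family_ccp_map[OF ccp])
  have "gauge n (0, - A) \<le> 0"
    using nonneg[OF ccp, of \<xi>] attained by (simp add: amplification_uminus)
  then show ?thesis
    using gauge_nonneg[OF n, of "(0, - A)"] by (intro pos_if_gauge_uminus_zero[OF n A]) simp
qed

text \<open>All forms vanish on the self-adjoint matrix \<open>\<i> (A - A\<^sup>*)\<close>, so its norm is \<open>0\<close>.\<close>
lemma sa_mats_if_ccp_maps_real:
  assumes n: "1 \<le> n" and A: "A \<in> mats n n"
    and real: "\<And>\<phi> d \<xi>. ccp_map \<phi> d \<Longrightarrow> Im (amplification (map_form d \<phi>) n n A \<xi> \<xi>) = 0"
  shows "A \<in> sa_mats st n"
proof -
  define S where "S = mscale sc \<i> (A - mstar st A)"
  have "i < n \<and> j < n" if "S i j \<noteq> 0" for i j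
  proof -
    have "A i j \<noteq> 0 \<or> A j i \<noteq> 0" using that by (auto simp: S_def mscale_def mstar_def)
    then show ?thesis using A unfolding mats_def by blast
  qed
  moreover have "st (S j i) = S i j" for i j
    by (simp add: S_def mscale_def mstar_def st_scale st_diff scale_right_diff_distrib)
  ultimately have S: "S \<in> sa_mats st n" unfolding sa_mats_iff by blast
  have "nrm n n S \<le> 0"
  proof (rule nrm_le_if_ccp_maps_le[OF n S])
    fix \<phi> d \<xi> assume ccp: "ccp_map \<phi> d"
    interpret hermitian_form_family sc st "map_form d \<phi>"
      by (rule hermitian_form_family_ccp_map[OF ccp])
    have "amplification (map_form d \<phi>) n n S \<xi> \<xi> = 0"
      using real[OF ccp, of \<xi>]
      unfolding S_def amplification_mscale amplification_diff amplification_mstar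
      by (simp add: complex_eq_iff)
    then show "\<bar>Re (amplification (map_form d \<phi>) n n S \<xi> \<xi>)\<bar> \<le> 0" by simp
  qed
  then have "S = 0"
    using nrm_nonneg[OF n n sa_mats_mats[OF S]] nrm_eq_0_iff[OF n n sa_mats_mats[OF S]] by simp
  have "st (A j i) = A i j" for i j
  proof -
    have "S i j = 0" using \<open>S = 0\<close> by simp
    then show ?thesis by (simp add: S_def mscale_def mstar_def)
  qed
  then have "mstar st A = A" by (simp add: mstar_def)
  then show ?thesis using A unfolding sa_mats_def by blast
qed

definition ccp_blocks :: "(('v \<Rightarrow> nat \<Rightarrow> nat \<Rightarrow> complex) \<times> nat) set" where
  "ccp_blocks = {(\<phi>, d). ccp_map \<phi> d}"

abbreviation ccp_index :: "(('v \<Rightarrow> nat \<Rightarrow> nat \<Rightarrow> complex) \<times> nat \<times> nat) set" where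
  "ccp_index \<equiv> block_index ccp_blocks"

definition universal_rep :: "'v \<Rightarrow> (('v \<Rightarrow> nat \<Rightarrow> nat \<Rightarrow> complex) \<times> nat \<times> nat \<Rightarrow> complex) \<Rightarrow>
    ('v \<Rightarrow> nat \<Rightarrow> nat \<Rightarrow> complex) \<times> nat \<times> nat \<Rightarrow> complex" where
  "universal_rep v = block_diag ccp_blocks (\<lambda>\<phi>. \<phi> v)"

lemma ccp_blocks_iff [simp]: "(\<phi>, d) \<in> ccp_blocks \<longleftrightarrow> ccp_map \<phi> d"
  by (simp add: ccp_blocks_def)

lemma universal_rep_scale_add:
  "universal_rep (sc a v + w) x = (\<lambda>t. a * universal_rep v x t + universal_rep w x t)"
proof
  fix t :: "('v \<Rightarrow> nat \<Rightarrow> nat \<Rightarrow> complex) \<times> nat \<times> nat"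
  obtain \<phi> d r where t: "t = (\<phi>, d, r)" by (cases t)
  show "universal_rep (sc a v + w) x t = a * universal_rep v x t + universal_rep w x t"
  proof (cases "ccp_map \<phi> d")
    case True
    then have "\<phi> (sc a v + w) r s = a * \<phi> v r s + \<phi> w r s" for s
      unfolding ccp_map_def Vector_Spaces.linear_iff by simp
    then show ?thesis
      by (simp add: t universal_rep_def block_diag_def cmat_apply_def sum_distrib_left sum.distrib
          distrib_right mult.assoc)
  qed (simp add: t universal_rep_def block_diag_def)
qed

context
  fixes n m :: nat and A :: "nat \<Rightarrow> nat \<Rightarrow> 'v"
  assumes nm: "1 \<le> n" "1 \<le> m" and A: "A \<in> mats n m"
begin

lemma ccp_block_le:
  "(\<phi>, d) \<in> ccp_blocks \<Longrightarrow>
    hn_norm {..<d} n (opmat_apply m (\<lambda>i j. cmat_apply d (\<phi> (A i j))) \<xi>)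
        \<le> nrm n m A * hn_norm {..<d} m \<xi>"
  using hn_norm_ccp_map_apply_le[OF _ nm A] by simp

lemma opmat_apply_universal_rep_l2: "(\<And>j. j < m \<Longrightarrow> x j \<in> l2 ccp_index) \<Longrightarrow> i < n \<Longrightarrow>
    opmat_apply m (\<lambda>i j. universal_rep (A i j)) x i \<in> l2 ccp_index"
  unfolding universal_rep_def using block_diag_l2[OF nrm_nonneg[OF nm A] ccp_block_le] .

lemma hn_norm_universal_rep_le: "(\<And>j. j < m \<Longrightarrow> x j \<in> l2 ccp_index) \<Longrightarrow>
    hn_norm ccp_index n (opmat_apply m (\<lambda>i j. universal_rep (A i j)) x)
      \<le> nrm n m A * hn_norm ccp_index m x"
  unfolding universal_rep_def using hn_norm_block_diag_le[OF nrm_nonneg[OF nm A] ccp_block_le] .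

lemma opmat_norm_universal_rep_nonneg: "0 \<le> opmat_norm ccp_index n m (\<lambda>i j. universal_rep (A i j))"
  by (rule opmat_norm_nonneg[OF nrm_nonneg[OF nm A] hn_norm_universal_rep_le])

lemma opmat_norm_universal_rep_le:
  "opmat_norm ccp_index n m (\<lambda>i j. universal_rep (A i j)) \<le> nrm n m A"
  unfolding universal_rep_def
  by (rule opmat_norm_block_diag_le[OF nrm_nonneg[OF nm A] ccp_block_le])

lemma hn_norm_ccp_map_le_opmat_norm_universal_rep:
  assumes "ccp_map \<phi> d"
  shows "hn_norm {..<d} n (opmat_apply m (\<lambda>i j. cmat_apply d (\<phi> (A i j))) \<xi>)
    \<le> opmat_norm ccp_index n m (\<lambda>i j. universal_rep (A i j)) * hn_norm {..<d} m \<xi>"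
  unfolding universal_rep_def
  using assms
  by (intro block_le_opmat_norm[where M = "\<lambda>i j \<phi>. \<phi> (A i j)",
        OF nrm_nonneg[OF nm A] ccp_block_le]) simp_all

lemma opmat_norm_universal_rep_ge:
  "nrm n m A \<le> opmat_norm ccp_index n m (\<lambda>i j. universal_rep (A i j))"
    (is "_ \<le> ?M")
proof -
  have "nrm (n + m) (n + m) (sa_dilation n A) \<le> ?M"
  proof (rule nrm_le_if_ccp_maps_le[OF _ sa_mats_sa_dilation[OF A]])
    fix \<phi> d \<eta> assume ccp: "ccp_map \<phi> d" and \<eta>: "hn_norm {..<d} (n + m) \<eta> \<le> 1"
    interpret hermitian_form_family sc st "map_form d \<phi>"
      by (rule hermitian_form_family_ccp_map[OF ccp])
    define \<xi> where "\<xi> = (\<lambda>j. \<eta> (n + j))"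
    define a where "a = hn_norm {..<d} n \<eta>"
    define b where "b = hn_norm {..<d} m \<xi>"
    let ?T = "opmat_apply m (\<lambda>i j. cmat_apply d (\<phi> (A i j))) \<xi>"
    have "a\<^sup>2 + b\<^sup>2 = (hn_norm {..<d} (n + m) \<eta>)\<^sup>2"
      unfolding a_def b_def \<xi>_def hn_norm_lessThan_sq sum_lessThan_add ..
    also have "\<dots> \<le> 1" using \<eta> by (simp add: power_le_one)
    finally have "2 * a * b \<le> 1" using sum_squares_bound[of a b] by simp
    have T: "hn_norm {..<d} n ?T \<le> ?M * b"
      unfolding b_def by (rule hn_norm_ccp_map_le_opmat_norm_universal_rep[OF ccp])
    have "\<bar>Re (amplification (map_form d \<phi>) (n + m) (n + m) (sa_dilation n A) \<eta> \<eta>)\<bar>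
        = 2 * \<bar>Re (amplification (map_form d \<phi>) n m A \<eta> \<xi>)\<bar>"
      by (simp add: amplification_sa_dilation \<xi>_def abs_mult)
    also have "\<dots> \<le> 2 * cmod (hn_inner {..<d} n ?T \<eta>)"
      unfolding amplification_map_form_eq_hn_inner using abs_Re_le_cmod by simp
    also have "\<dots> \<le> 2 * (hn_norm {..<d} n ?T * a)"
      unfolding a_def using cmod_hn_inner_le by simp
    also have "\<dots> \<le> 2 * (?M * b * a)"
      using T by (simp add: a_def mult_right_mono)
    also have "\<dots> = ?M * (2 * a * b)" by simp
    also have "\<dots> \<le> ?M"
      using \<open>2 * a * b \<le> 1\<close> by (intro mult_left_le opmat_norm_universal_rep_nonneg)
    finally show "\<bar>Re (amplification (map_form d \<phi>) (n + m) (n + m) (sa_dilation n A) \<eta> \<eta>)\<bar> \<le> ?M" .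
  qed (use nm in simp)
  then show ?thesis unfolding nrm_sa_dilation[OF nm A] .
qed

lemma opmat_norm_universal_rep: "opmat_norm ccp_index n m (\<lambda>i j. universal_rep (A i j)) = nrm n m A"
  using opmat_norm_universal_rep_le opmat_norm_universal_rep_ge by (rule antisym)

end

lemma linear_into_B_universal_rep: "linear_into_B sc ccp_index universal_rep"
  unfolding linear_into_B_def
proof (intro conjI allI ballI)
  fix v :: 'v
  define A where "A = (\<lambda>i j. if i = (0::nat) \<and> j = (0::nat) then v else 0)"
  have A: "A \<in> mats 1 1" unfolding A_def mats_def by auto
  have apply_A: "opmat_apply 1 (\<lambda>i j. universal_rep (A i j)) (\<lambda>_. x) 0 = universal_rep v x" for x
    unfolding opmat_apply_def A_def by simp
  have hn_norm_1: "hn_norm ccp_index 1 z = l2norm ccp_index (z 0)" for z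
    unfolding hn_norm_def by (simp add: l2norm_def infsum_nonneg)
  show "bounded_op ccp_index (universal_rep v)"
    unfolding bounded_op_def
  proof (intro conjI allI ballI exI[of _ "nrm 1 1 A"])
    fix x assume x: "x \<in> l2 ccp_index"
    have "opmat_apply 1 (\<lambda>i j. universal_rep (A i j)) (\<lambda>_. x) 0 \<in> l2 ccp_index"
      by (rule opmat_apply_universal_rep_l2[OF order_refl order_refl A]) (simp_all add: x)
    then show "universal_rep v x \<in> l2 ccp_index" unfolding apply_A .
    have "hn_norm ccp_index 1 (opmat_apply 1 (\<lambda>i j. universal_rep (A i j)) (\<lambda>_. x))
        \<le> nrm 1 1 A * hn_norm ccp_index 1 (\<lambda>_. x)"
      by (rule hn_norm_universal_rep_le[OF order_refl order_refl A]) (simp add: x)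
    then show "l2norm ccp_index (universal_rep v x) \<le> nrm 1 1 A * l2norm ccp_index x"
      unfolding hn_norm_1 apply_A .
  next
    show "universal_rep v (\<lambda>i. c * x i + y i)
        = (\<lambda>i. c * universal_rep v x i + universal_rep v y i)" for x y c
      by (simp add: universal_rep_def block_diag_add block_diag_scale)
  qed
next
  show "universal_rep (sc a v + w) x
      = (\<lambda>t. a * universal_rep v x t + universal_rep w x t)" for a v w x
    by (rule universal_rep_scale_add)
qed

lemma opmat_pos_universal_rep_iff:
  assumes n: "1 \<le> n" and A: "A \<in> mats n n"
  shows "opmat_pos ccp_index n (\<lambda>i j. universal_rep (A i j)) \<longleftrightarrow> A \<in> pos n"
proof -
  have "opmat_pos ccp_index n (\<lambda>i j. universal_rep (A i j)) \<longleftrightarrow>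
      (\<forall>\<phi> d \<xi>. ccp_map \<phi> d \<longrightarrow> 0 \<le> amplification (map_form d \<phi>) n n A \<xi> \<xi>)"
    unfolding universal_rep_def amplification_map_form_eq_hn_inner
    by (subst opmat_pos_block_diag_iff[where M = "\<lambda>i j \<phi>. \<phi> (A i j)",
          OF nrm_nonneg[OF n n A] ccp_block_le[OF n n A]]) (auto simp: ccp_blocks_def)
  also have "\<dots> \<longleftrightarrow> A \<in> pos n"
  proof
    assume forms: "\<forall>\<phi> d \<xi>. ccp_map \<phi> d \<longrightarrow> 0 \<le> amplification (map_form d \<phi>) n n A \<xi> \<xi>"
    have "A \<in> sa_mats st n"
      using forms by (intro sa_mats_if_ccp_maps_real[OF n A]) (auto simp: less_eq_complex_def)
    then show "A \<in> pos n"
      using forms by (intro pos_if_ccp_maps_nonneg[OF n]) (auto simp: less_eq_complex_def)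
  next
    assume pos: "A \<in> pos n"
    show "\<forall>\<phi> d \<xi>. ccp_map \<phi> d \<longrightarrow> 0 \<le> amplification (map_form d \<phi>) n n A \<xi> \<xi>"
    proof (intro allI impI)
      fix \<phi> d \<xi> assume ccp: "ccp_map \<phi> d"
      interpret hermitian_form_family sc st "map_form d \<phi>"
        by (rule hermitian_form_family_ccp_map[OF ccp])
      have "mstar st A = A" using pos_sa_mats[OF n pos] unfolding sa_mats_def by blast
      then have "Im (amplification (map_form d \<phi>) n n A \<xi> \<xi>) = 0"
        using amplification_mstar[of n n A \<xi> \<xi>] by (simp add: complex_eq_iff)
      then show "0 \<le> amplification (map_form d \<phi>) n n A \<xi> \<xi>"
        using Re_amplification_ccp_map_nonneg[OF ccp n pos] by (simp add: less_eq_complex_def)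
    qed
  qed
  finally show ?thesis .
qed

end

theorem theorem3p2:
  fixes sc :: "complex \<Rightarrow> 'v::ab_group_add \<Rightarrow> 'v"
    and st :: "'v \<Rightarrow> 'v"
    and nrm :: "nat \<Rightarrow> nat \<Rightarrow> (nat \<Rightarrow> nat \<Rightarrow> 'v) \<Rightarrow> real"
    and pos :: "nat \<Rightarrow> (nat \<Rightarrow> nat \<Rightarrow> 'v) set"
  assumes "normal_mo_star_opspace sc st nrm pos"
  shows "\<exists>(I :: (('v \<Rightarrow> nat \<Rightarrow> nat \<Rightarrow> complex) \<times> nat \<times> nat) set)
            (\<phi> :: 'v \<Rightarrow> (((('v \<Rightarrow> nat \<Rightarrow> nat \<Rightarrow> complex) \<times> nat \<times> nat) \<Rightarrow> complex)
                       \<Rightarrow> ((('v \<Rightarrow> nat \<Rightarrow> nat \<Rightarrow> complex) \<times> nat \<times> nat) \<Rightarrow> complex))).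
           linear_into_B sc I \<phi> \<and>
           (\<forall>n m A. 1 \<le> n \<longrightarrow> 1 \<le> m \<longrightarrow> A \<in> mats n m \<longrightarrow>
              opmat_norm I n m (\<lambda>i j. \<phi> (A i j)) = nrm n m A) \<and>
           (\<forall>n A. 1 \<le> n \<longrightarrow> A \<in> mats n n \<longrightarrow>
              (opmat_pos I n (\<lambda>i j. \<phi> (A i j)) \<longleftrightarrow> A \<in> pos n))"
proof -
  interpret normal_space sc st nrm pos by unfold_locales (rule assms)
  show ?thesis
  proof (intro exI conjI allI impI)
    show "linear_into_B sc ccp_index universal_rep" by (rule linear_into_B_universal_rep)
    show "opmat_norm ccp_index n m (\<lambda>i j. universal_rep (A i j)) = nrm n m A"
      if "1 \<le> n" "1 \<le> m" "A \<in> mats n m" for n m A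
      using that by (rule opmat_norm_universal_rep)
    show "opmat_pos ccp_index n (\<lambda>i j. universal_rep (A i j)) \<longleftrightarrow> A \<in> pos n"
      if "1 \<le> n" "A \<in> mats n n" for n A
      using that by (rule opmat_pos_universal_rep_iff)
  qed
qed

end
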